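(* Let $G=(V\cup B,E)$ be a connected graph with boundary vertices $B$ and interior vertices $V$, $|V|=n$. Given an initial profile $f_0:V\cup B\to[0,1]$, let $h$ denote the infinity harmonic extension of $f_0|_B$ from $B$ to $V$, and run the Lipschitz learning dynamics with boundary values $f_0|_B$ and i.i.d. uniformly random update vertices in $V$. Then: (a) for all integers $t\ge 0$, $\ \mathbb{E}[\|f_t-h\|_1]\le n\,e^{-t/(2n^3)}$; (b) for all $0<\epsilon<1$, the $\epsilon$-approximation time satisfies $\ \mathbb{E}[\tau^*(\epsilon)]\le 1+2n^3\log\frac{ne}{\epsilon}$. Conversely, there is an absolute constant $c>0$ such that for every $n\ge 2$, on the segment of length $n$ (the path with vertices $\{0,1,\ldots,n\}$ and edges $\{i,i+1\}$, with $B=\{0,n\}$) with boundary values $1$ at the endpoints and initial profile $0$ in the interior, we have $\tau^*(1/2)\ge c\,n^3$ for any sequence of update vertices in $\{1,\ldots,n-1\}$.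
   Context: All graphs are finite, undirected and simple. The vertex set of $G$ is the disjoint union of nonempty sets $B$ (boundary) and $V$ (interior), and there are no edges between vertices of $B$. Lipschitz learning with prescribed boundary values: given $f_0$ and update vertices $v_1,v_2,\ldots\in V$, for $t\ge 1$ set $f_t(v_t)=\frac12\bigl(\max_{u\sim v_t}f_{t-1}(u)+\min_{w\sim v_t}f_{t-1}(w)\bigr)$ and $f_t(v)=f_{t-1}(v)$ for $v\ne v_t$; boundary vertices are never updated. In the random dynamics the $v_t$ are independent and uniform on $V$. A function $h:V\cup B\to\mathbb{R}$ is infinity harmonic on $V$ if $h(v)=\frac12(\max_{u\sim v}h(u)+\min_{w\sim v}h(w))$ for all $v\in V$; it is known that any boundary data on $B$ has a unique extension to $V\cup B$ that is infinity harmonic on $V$ (the infinity harmonic extension). $\|\cdot\|_1$ and $\|\cdot\|_\infty$ are the $\ell^1$ and sup norms over vertices. $\tau^*(\epsilon)=\min\{t\ge 0:\ \|f_t-h\|_\infty\le\epsilon\}$. *)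

theory Defs
  imports "HOL-Probability.Probability" "Graph_Theory.Pair_Digraph" "Graph_Theory.Digraph_Component"
begin

text \<open>
  Following Graph_Theory, a finite simple undirected graph is a \<open>pair_graph\<close>: finite, loop-free,
  with a symmetric set of arcs.
\<close>

locale boundary_graph = pair_graph G for G :: "'a pair_pre_digraph" +
  fixes V B :: "'a set"
  assumes vertex_partition: "pverts G = V \<union> B" "V \<inter> B = {}"
    and interior_nonempty: "V \<noteq> {}"
    and boundary_nonempty: "B \<noteq> {}"
    and boundary_independent: "b \<in> B \<Longrightarrow> b' \<in> B \<Longrightarrow> (b, b') \<notin> parcs G"

definition neighbours :: "'a pair_pre_digraph \<Rightarrow> 'a \<Rightarrow> 'a set" where
  "neighbours G v = {u. (v, u) \<in> parcs G}"

definition midrange :: "'a pair_pre_digraph \<Rightarrow> ('a \<Rightarrow> real) \<Rightarrow> 'a \<Rightarrow> real" where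
  "midrange G f v = (Max (f ` neighbours G v) + Min (f ` neighbours G v)) / 2"

definition infinity_harmonic :: "'a pair_pre_digraph \<Rightarrow> 'a set \<Rightarrow> ('a \<Rightarrow> real) \<Rightarrow> bool" where
  "infinity_harmonic G V h \<longleftrightarrow> (\<forall>v\<in>V. h v = midrange G h v)"

text \<open>
  On the vertices of a connected graph with boundary, the extension of given boundary data exists
  and is unique; values of \<open>h\<close> off the vertex set are irrelevant.
\<close>

definition infinity_harmonic_extension ::
    "'a pair_pre_digraph \<Rightarrow> 'a set \<Rightarrow> 'a set \<Rightarrow> ('a \<Rightarrow> real) \<Rightarrow> ('a \<Rightarrow> real) \<Rightarrow> bool" where
  "infinity_harmonic_extension G V B g h \<longleftrightarrow>
     infinity_harmonic G V h \<and> (\<forall>b\<in>B. h b = g b)"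

text \<open>
  The update vertices are \<open>v 1, v 2, \<dots>\<close>; the value \<open>v 0\<close> is not used.
\<close>

primrec lipschitz_learning ::
    "'a pair_pre_digraph \<Rightarrow> ('a \<Rightarrow> real) \<Rightarrow> (nat \<Rightarrow> 'a) \<Rightarrow> nat \<Rightarrow> 'a \<Rightarrow> real" where
  "lipschitz_learning G f0 v 0 = f0"
| "lipschitz_learning G f0 v (Suc t) =
     (lipschitz_learning G f0 v t)
       (v (Suc t) := midrange G (lipschitz_learning G f0 v t) (v (Suc t)))"

definition l1_norm :: "'a pair_pre_digraph \<Rightarrow> ('a \<Rightarrow> real) \<Rightarrow> real" where
  "l1_norm G g = (\<Sum>x\<in>pverts G. \<bar>g x\<bar>)"

definition sup_norm :: "'a pair_pre_digraph \<Rightarrow> ('a \<Rightarrow> real) \<Rightarrow> real" where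
  "sup_norm G g = Max ((\<lambda>x. \<bar>g x\<bar>) ` pverts G)"

text \<open>The infimum is a minimum, or \<open>\<infinity>\<close> if the accuracy \<open>\<epsilon>\<close> is never reached.\<close>

definition approximation_time ::
    "'a pair_pre_digraph \<Rightarrow> ('a \<Rightarrow> real) \<Rightarrow> ('a \<Rightarrow> real) \<Rightarrow> (nat \<Rightarrow> 'a) \<Rightarrow> real \<Rightarrow> enat" where
  "approximation_time G f0 h v \<epsilon> =
     Inf (enat ` {t. sup_norm G (\<lambda>x. lipschitz_learning G f0 v t x - h x) \<le> \<epsilon>})"

definition iid_uniform_updates ::
    "'w measure \<Rightarrow> 'a set \<Rightarrow> (nat \<Rightarrow> 'w \<Rightarrow> 'a) \<Rightarrow> bool" where
  "iid_uniform_updates M V X \<longleftrightarrow>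
     prob_space.indep_vars M (\<lambda>_. count_space V) X {1..} \<and>
     (\<forall>t\<ge>1. distr M (count_space V) (X t) = uniform_count_measure V)"

definition segment_graph :: "nat \<Rightarrow> nat pair_pre_digraph" where
  "segment_graph n =
     \<lparr> pverts = {0..n}, parcs = {(i, j). i \<le> n \<and> j \<le> n \<and> (j = i + 1 \<or> i = j + 1)} \<rparr>"

definition segment_boundary :: "nat \<Rightarrow> nat set" where
  "segment_boundary n = {0, n}"

definition segment_interior :: "nat \<Rightarrow> nat set" where
  "segment_interior n = {1..n - 1}"

definition segment_profile :: "nat \<Rightarrow> nat \<Rightarrow> real" where
  "segment_profile n i = (if i \<in> segment_boundary n then 1 else 0)"

end

(*
Mass bound. Let f be superharmonic and h infinity harmonic with f <= h on B, and let M be the maximum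
of f - h. By the pigeonhole principle there is a set A of interior vertices such that f - h drops
by at least M / n along every edge that leaves A. Follow a path of steepest descent for h out of A;
the last vertex x of A on it has the largest slope S of h in A, so that f falls by at least S + M / n at x.
An ascending path for f from x has to leave A as well, through an edge where f rises by at most S - M / n.
Slopes of f along such a path drop only by twice the deficits f v - midrange f v it meets, so the
deficits add up to at least M / (2 n). A uniform update therefore contracts the mass of f - h by
the factor 1 - 1 / (2 n^3). Starting from the interior values 1 and 0 gives barriers
for the dynamics from above and below, and (b) follows from (a) by Markov's inequality.

Lower bound. An update on the segment with increment d at the vertex i lowers a weighted Dirichlet
energy by a multiple of the square of u_i d, up to an error 4 n^2 d, where u_i is of order n^2 in the bulk.
The increments sum up to at most n, so by the inequality between the arithmetic and geometric means
a single step raises the potential below by at most a constant, while it has to become of order n^3.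
*)
theory Submission
  imports Defs
begin

section \<open>Deficits of superharmonic functions\<close>

lemma midrange_uminus:
  assumes "finite (neighbours G v)" "neighbours G v \<noteq> {}"
  shows "midrange G (\<lambda>x. - f x) v = - midrange G f v"
proof -
  have A: "finite (f ` neighbours G v)" "f ` neighbours G v \<noteq> {}" using assms by auto
  have img: "(\<lambda>x. - f x) ` neighbours G v = uminus ` f ` neighbours G v" by (auto simp: image_image)
  have "Max (uminus ` f ` neighbours G v) = - Min (f ` neighbours G v)"
    using A by (intro Max_eqI) auto
  moreover have "Min (uminus ` f ` neighbours G v) = - Max (f ` neighbours G v)"
    using A by (intro Min_eqI) auto
  ultimately show ?thesis unfolding midrange_def img by (simp add: field_simps)
qed

lemma midrange_mono:
  assumes "finite (neighbours G v)" "neighbours G v \<noteq> {}" "\<And>u. u \<in> neighbours G v \<Longrightarrow> f u \<le> g u"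
  shows "midrange G f v \<le> midrange G g v"
proof -
  have "Max (f ` neighbours G v) \<le> Max (g ` neighbours G v)"
  proof (rule Max.boundedI)
    fix a assume "a \<in> f ` neighbours G v"
    then obtain u where "u \<in> neighbours G v" "a = f u" by blast
    then show "a \<le> Max (g ` neighbours G v)"
      using assms by (intro Max.coboundedI[THEN order_trans[rotated]]) auto
  qed (use assms in auto)
  moreover have "Min (f ` neighbours G v) \<le> Min (g ` neighbours G v)"
  proof (rule Min.boundedI)
    fix a assume "a \<in> g ` neighbours G v"
    then obtain u where "u \<in> neighbours G v" "a = g u" by blast
    then show "Min (f ` neighbours G v) \<le> a"
      using assms by (intro Min.coboundedI[THEN order_trans]) auto
  qed (use assms in auto)
  ultimately show ?thesis unfolding midrange_def by simp
qed

lemma midrange_cong: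
  assumes "\<And>u. u \<in> neighbours G v \<Longrightarrow> f u = g u"
  shows "midrange G f v = midrange G g v"
proof -
  have "f ` neighbours G v = g ` neighbours G v" using assms by (intro image_cong) auto
  then show ?thesis by (simp add: midrange_def)
qed

lemma midrange_const: "neighbours G v \<noteq> {} \<Longrightarrow> midrange G (\<lambda>_. c) v = c"
  by (simp add: midrange_def image_constant_conv)

section \<open>Connected graphs with boundary\<close>

locale connected_boundary_graph = boundary_graph +
  assumes connected: "Digraph_Component.connected (with_proj G)"
begin

text \<open>A walk from \<open>x\<close> to \<open>y\<close> has to step out of \<open>A\<close>.
  Symmetric arcs make a connected graph strongly connected, so the walk can be taken along
  arcs.\<close>

lemma exists_exit_edge:
  assumes "A \<subseteq> pverts G" "x \<in> A" "y \<in> pverts G - A"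
  obtains u w where "u \<in> A" "w \<notin> A" "w \<in> neighbours G u"
proof -
  have "symmetric (with_proj G)" using symmetric_def sym_arcs by blast
  then have "strongly_connected (with_proj G)"
    using connected by (rule symmetric_connected_imp_strongly_connected)
  then have "x \<rightarrow>\<^sup>*\<^bsub>with_proj G\<^esub> y" using assms unfolding strongly_connected_def by auto
  then have "y \<in> A \<or> (\<exists>u w. u \<in> A \<and> w \<notin> A \<and> (u, w) \<in> parcs G)"
  proof (induction rule: reachable_induct)
    case base
    then show ?case using assms by simp
  next
    case (step u w)
    have "(u, w) \<in> parcs G" using step(2) by (simp add: arcs_ends_def arc_to_ends_def)
    then show ?case using step by blast
  qed
  then show thesis using assms that by (auto simp: neighbours_def)
qed

lemma finite_V: "finite V" and finite_B: "finite B"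
  using pair_finite_verts vertex_partition(1) by simp_all

lemma neighbours_subset: "neighbours G v \<subseteq> V \<union> B"
  using arc_snd_in_verts vertex_partition(1) by (fastforce simp: neighbours_def)

lemma finite_neighbours: "finite (neighbours G v)"
  using neighbours_subset finite_V finite_B finite_subset by blast

lemma neighbours_sym: "u \<in> neighbours G v \<Longrightarrow> v \<in> neighbours G u"
  by (simp add: neighbours_def arcs_symmetric)

lemma not_self_neighbour: "v \<notin> neighbours G v"
  using pair_no_loops by (fastforce simp: neighbours_def)

text \<open>Some boundary vertex lies outside \<open>{v}\<close>, so \<open>{v}\<close> has an exit
  edge. This keeps \<open>Max\<close> and \<open>Min\<close> in \<open>midrange\<close>
  meaningful.\<close>

lemma neighbours_nonempty:
  assumes "v \<in> V" shows "neighbours G v \<noteq> {}"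
proof -
  obtain b where "b \<in> B" using boundary_nonempty by blast
  then have "b \<in> pverts G - {v}" "{v} \<subseteq> pverts G" using assms vertex_partition by auto
  then show ?thesis using exists_exit_edge[of "{v}" v b] by blast
qed

lemma card_V_pos: "card V > 0"
  using finite_V interior_nonempty by (simp add: card_gt_0_iff)

section \<open>Superharmonic functions and the deficit bound\<close>

abbreviation superharmonic :: "('a \<Rightarrow> real) \<Rightarrow> bool" where
  "superharmonic f \<equiv> \<forall>v\<in>V. midrange G f v \<le> f v"

lemma neighbour_max:
  assumes "v \<in> V"
  obtains u where "u \<in> neighbours G v" "(f u :: real) = Max (f ` neighbours G v)"
  using Max_in[of "f ` neighbours G v"] finite_neighbours neighbours_nonempty[OF assms] 
  by (metis (no_types, lifting) finite_imageI image_iff image_is_empty)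

lemma neighbour_min:
  assumes "v \<in> V"
  obtains u where "u \<in> neighbours G v" "(f u :: real) = Min (f ` neighbours G v)"
  using Min_in[of "f ` neighbours G v"] finite_neighbours neighbours_nonempty[OF assms] 
  by (metis (no_types, lifting) finite_imageI image_iff image_is_empty)

lemma le_Max_neighbours: "u \<in> neighbours G v \<Longrightarrow> (f u :: real) \<le> Max (f ` neighbours G v)"
  and Min_neighbours_le: "u \<in> neighbours G v \<Longrightarrow> Min (f ` neighbours G v) \<le> (f u :: real)"
  using finite_neighbours by auto

text \<open>Steepest descent for an infinity harmonic function does not lose slope: an edge down
  from a vertex is an edge up at its lower end, where the steepest slopes up and down agree. Among
  the vertices of maximal slope in \<open>A\<close>, one with the smallest value of \<open>h\<close>
  must therefore descend out of \<open>A\<close>.\<close>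

lemma steepest_exit:
  assumes A: "A \<subseteq> V" "A \<noteq> {}" and harm: "infinity_harmonic G V h"
  obtains x y where "x \<in> A" "y \<in> neighbours G x" "y \<notin> A" "h y \<le> h x"
    "\<And>v u. v \<in> A \<Longrightarrow> u \<in> neighbours G v \<Longrightarrow> h u - h v \<le> h x - h y"
proof -
  define s where "s v = Max (h ` neighbours G v) - h v" for v
  have down: "h v - Min (h ` neighbours G v) = s v" if "v \<in> A" for v
  proof -
    have "h v = midrange G h v" using that A harm by (auto simp: infinity_harmonic_def)
    then show ?thesis by (simp add: midrange_def s_def)
  qed
  have up: "h u - h v \<le> s v" if "u \<in> neighbours G v" for u v
    using le_Max_neighbours[OF that, of h] by (simp add: s_def)
  have finA: "finite A" using A finite_V finite_subset by blast
  define S where "S = Max (s ` A)"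
  have sS: "s v \<le> S" if "v \<in> A" for v using that finA by (simp add: S_def)
  have "S \<in> s ` A" unfolding S_def using A finA by (intro Max_in) auto
  then obtain x0 where x0: "x0 \<in> A" "s x0 = S" by auto
  have "0 \<le> S"
  proof -
    obtain u where "u \<in> neighbours G x0" using x0 A neighbours_nonempty by blast
    then show ?thesis
      using up[of u x0] down[OF x0(1)] Min_neighbours_le[of u x0 h] x0 by simp
  qed
  have ex: "\<exists>x y. x \<in> A \<and> y \<in> neighbours G x \<and> y \<notin> A \<and> h x - h y \<ge> S"
  proof (cases "S = 0")
    \<comment> \<open>With slope zero a descent step need not lower \<open>h\<close>, so minimality
      gives nothing. But then \<open>h\<close> rises along no edge from a vertex of
      \<open>A\<close>, and any exit edge serves.\<close>
    case True
    obtain b where b: "b \<in> B" using boundary_nonempty by blast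
    have "b \<in> pverts G - A" "A \<subseteq> pverts G" using b A vertex_partition by auto
    then obtain u w where uw: "u \<in> A" "w \<notin> A" "w \<in> neighbours G u"
      using exists_exit_edge[of A x0 b] x0 by blast
    have "h w - h u \<le> 0" using up[OF uw(3)] sS[OF uw(1)] True by simp
    then show ?thesis using uw True by (intro exI[of _ u] exI[of _ w]) auto
  next
    case False
    then have "S > 0" using \<open>0 \<le> S\<close> by simp
    define A' where "A' = {x\<in>A. s x = S}"
    have "finite A'" "A' \<noteq> {}" using finA x0 by (auto simp: A'_def)
    then have "Min (h ` A') \<in> h ` A'" by (intro Min_in) auto
    then obtain x where "x \<in> A'" "h x = Min (h ` A')" by auto
    with \<open>finite A'\<close> have x: "x \<in> A'" "\<And>z. z \<in> A' \<Longrightarrow> h x \<le> h z" by auto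
    then have xA: "x \<in> A" "s x = S" by (auto simp: A'_def)
    obtain y where y: "y \<in> neighbours G x" "h y = Min (h ` neighbours G x)"
      using neighbour_min[of x] xA A by blast
    have hy: "h x - h y = S" using down[OF xA(1)] y xA by simp
    have "y \<notin> A"
    proof
      assume "y \<in> A"
      \<comment> \<open>The edge from \<open>y\<close> back to \<open>x\<close> climbs by
        \<open>S\<close>, so \<open>y\<close> would be a vertex of maximal slope strictly below
        \<open>x\<close>.\<close>
      then have "s y = S" using up[OF neighbours_sym[OF y(1)]] sS hy by force
      then have "y \<in> A'" using \<open>y \<in> A\<close> by (simp add: A'_def)
      then show False using x(2) hy \<open>S > 0\<close> by force
    qed
    then show ?thesis using xA y hy by (intro exI[of _ x] exI[of _ y]) auto
  qed
  then obtain x y where xy: "x \<in> A" "y \<in> neighbours G x" "y \<notin> A" "h x - h y \<ge> S" by blast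
  show thesis
  proof (rule that[of x y])
    show "h u - h v \<le> h x - h y" if "v \<in> A" "u \<in> neighbours G v" for v u
      using up[OF that(2)] sS[OF that(1)] xy(4) by linarith
  qed (use xy \<open>0 \<le> S\<close> in auto)
qed

text \<open>At the steepest exit edge \<open>f\<close> falls by at least
  \<open>S + \<gamma>\<close>. If the deficits summed to less than \<open>\<gamma> / 2\<close>, an
  ascending path for \<open>f\<close> from \<open>x\<close> would rise by more than \<open>S\<close>
  at every step, whereas an edge leaving \<open>A\<close> rises by at most
  \<open>S - \<gamma>\<close>: the path could neither stop nor leave the finite set
  \<open>A\<close>.\<close>

lemma deficit_of_gap:
  assumes A: "A \<subseteq> V" "A \<noteq> {}" and super: "superharmonic f" and harm: "infinity_harmonic G V h"
    and gap: "\<And>v u. v \<in> A \<Longrightarrow> u \<in> neighbours G v \<Longrightarrow> u \<notin> A \<Longrightarrow> f u - h u + \<gamma> \<le> f v - h v"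
  shows "\<gamma> / 2 \<le> (\<Sum>v\<in>A. f v - midrange G f v)"
proof (rule ccontr)
  define d where "d v = f v - midrange G f v" for v
  assume "\<not> ?thesis"
  then have small: "(\<Sum>v\<in>A. d v) < \<gamma> / 2" by (simp add: d_def)
  have finA: "finite A" using A finite_V finite_subset by blast
  have d0: "d v \<ge> 0" if "v \<in> A" for v using that A super by (auto simp: d_def)
  \<comment> \<open>Twice the deficit is the difference between the steepest slopes down and
    up.\<close>
  have d: "Max (f ` neighbours G v) - f v = f v - Min (f ` neighbours G v) - 2 * d v" for v
    by (simp add: d_def midrange_def field_simps)
  obtain x y where xy: "x \<in> A" "y \<in> neighbours G x" "y \<notin> A" "h y \<le> h x"
    and steep: "\<And>v u. v \<in> A \<Longrightarrow> u \<in> neighbours G v \<Longrightarrow> h u - h v \<le> h x - h y"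
    using steepest_exit[OF A harm] by blast
  define S where "S = h x - h y"
  \<comment> \<open>\<open>P\<close> is the set of vertices of an ascending path for \<open>f\<close> that starts at \<open>x\<close> and ends at \<open>v\<close>:
    the slope of \<open>f\<close> along it drops by at most \<open>2 * d p\<close> at each vertex \<open>p\<close>.\<close>
  define good where "good v \<longleftrightarrow> (\<exists>P\<subseteq>A. v \<in> P \<and> (\<forall>p\<in>P. f p \<le> f v) \<and>
      S + \<gamma> - 2 * (\<Sum>p\<in>P. d p) \<le> Max (f ` neighbours G v) - f v)" for v
  have "good x"
    unfolding good_def
  proof (intro exI[of _ "{x}"] conjI)
    show "S + \<gamma> - 2 * (\<Sum>p\<in>{x}. d p) \<le> Max (f ` neighbours G x) - f x"
      using gap[OF xy(1-3)] Min_neighbours_le[OF xy(2), of f] d[of x] by (simp add: S_def)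
  qed (use xy in auto)
  \<comment> \<open>Choosing an end vertex of largest value replaces the construction of a whole
    path: one further extension contradicts the choice.\<close>
  define C where "C = {v\<in>A. good v}"
  have "finite C" "C \<noteq> {}" using finA xy(1) \<open>good x\<close> by (auto simp: C_def)
  then have "Max (f ` C) \<in> f ` C" by (intro Max_in) auto
  then obtain v where "v \<in> C" "f v = Max (f ` C)" by auto
  with \<open>finite C\<close> have vC: "v \<in> C" "\<And>z. z \<in> C \<Longrightarrow> f z \<le> f v" by auto
  then have vA: "v \<in> A" and "good v" by (auto simp: C_def)
  then obtain P where P: "P \<subseteq> A" "v \<in> P" "\<forall>p\<in>P. f p \<le> f v"
    "S + \<gamma> - 2 * (\<Sum>p\<in>P. d p) \<le> Max (f ` neighbours G v) - f v"
    unfolding good_def by blast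
  obtain z where z: "z \<in> neighbours G v" "f z = Max (f ` neighbours G v)"
    using neighbour_max[of v] vA A by blast
  have "(\<Sum>p\<in>P. d p) \<le> (\<Sum>p\<in>A. d p)" using P finA d0 by (intro sum_mono2) auto
  then have rise: "S < f z - f v" using P(4) small z by simp
  have "S \<ge> 0" using xy by (simp add: S_def)
  show False
  proof (cases "z \<in> A")
    case True
    \<comment> \<open>The vertex \<open>z\<close> lies strictly above the whole path, so its deficit
      enters the sum only once.\<close>
    have "z \<notin> P" using P(3) rise \<open>S \<ge> 0\<close> by force
    have "good z"
      unfolding good_def
    proof (intro exI[of _ "insert z P"] conjI)
      have "finite P" using P finA finite_subset by blast
      then have "(\<Sum>p\<in>insert z P. d p) = d z + (\<Sum>p\<in>P. d p)" using \<open>z \<notin> P\<close> by simp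
      then show "S + \<gamma> - 2 * (\<Sum>p\<in>insert z P. d p) \<le> Max (f ` neighbours G z) - f z"
        using d[of z] Min_neighbours_le[OF neighbours_sym[OF z(1)], of f] P(4) z(2) by simp
      show "\<forall>p\<in>insert z P. f p \<le> f z" using P(3) rise \<open>S \<ge> 0\<close> by fastforce
    qed (use True P in auto)
    then have "z \<in> C" using True by (simp add: C_def)
    then show False using vC(2) rise \<open>S \<ge> 0\<close> by force
  next
    case False
    have "\<gamma> > 0" using small d0 sum_nonneg[of A d] by force
    then show False using gap[OF vA z(1) False] steep[OF vA z(1)] rise by (simp add: S_def)
  qed
qed

text \<open>Let \<open>M\<close> be the excess at \<open>v0\<close> and cut the range from
  \<open>0\<close> to \<open>M\<close> into \<open>n\<close> intervals of length
  \<open>M / n\<close>. The other \<open>n - 1\<close> vertices miss one of them, and the vertices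
  above the missed interval form a set to which \<open>deficit_of_gap\<close> applies with
  \<open>\<gamma> = M / n\<close>.\<close>

lemma deficit_bound:
  assumes super: "superharmonic f" and harm: "infinity_harmonic G V h"
    and bdry: "\<And>b. b \<in> B \<Longrightarrow> f b \<le> h b" and v0: "v0 \<in> V"
  shows "f v0 - h v0 \<le> 2 * real (card V) * (\<Sum>v\<in>V. f v - midrange G f v)"
proof (cases "f v0 - h v0 > 0")
  case False
  have "0 \<le> (\<Sum>v\<in>V. f v - midrange G f v)" using super by (intro sum_nonneg) simp
  then have "0 \<le> 2 * real (card V) * (\<Sum>v\<in>V. f v - midrange G f v)" by simp
  then show ?thesis using False by linarith
next
  case True
  define M n where "M = f v0 - h v0" and "n = card V"
  have M: "M > 0" and n: "n > 0" using True card_V_pos by (simp_all add: M_def n_def)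
  define level where "level v = \<lfloor>real n * (f v - h v) / M\<rfloor>" for v
  have "card (level ` (V - {v0})) \<le> n - 1"
    using card_image_le[of "V - {v0}" level] finite_V v0 by (simp add: n_def)
  then have "card (level ` (V - {v0})) < card {0..<int n}" using n by simp
  then have "\<not> {0..<int n} \<subseteq> level ` (V - {v0})"
    using card_mono[of "level ` (V - {v0})" "{0..<int n}"] finite_V by auto
  then obtain k where k: "0 \<le> k" "k < int n" "k \<notin> level ` (V - {v0})"
    by (meson atLeastLessThan_iff subsetI)
  \<comment> \<open>The level of \<open>v0\<close> is just past the admissible levels
    \<open>0, ..., n - 1\<close>, so level \<open>k\<close> is missed by all of
    \<open>V\<close>.\<close>
  have "level v0 = int n" using M by (simp add: level_def M_def)
  then have lev: "level v \<noteq> k" if "v \<in> V" for v using that k by (cases "v = v0") auto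
  define A where "A = {v\<in>V. (k + 1) * M / n \<le> f v - h v}"
  have "real_of_int (k + 1) \<le> n" using k(2) by linarith
  then have "(k + 1) * M \<le> n * M" using M by (intro mult_right_mono) auto
  then have "v0 \<in> A" using v0 n by (simp add: A_def M_def[symmetric] divide_le_eq mult.commute)
  have below: "f u - h u \<le> k * M / n" if "u \<in> V \<union> B" "u \<notin> A" for u
  proof (cases "u \<in> V")
    case True
    then have "f u - h u < (k + 1) * M / n" using that by (simp add: A_def)
    then have "n * (f u - h u) / M < k + 1" using M n by (simp add: field_simps)
    then have "level u < k + 1" unfolding level_def by linarith
    then have "level u < k" using lev[OF True] by simp
    then have "n * (f u - h u) / M < k" unfolding level_def by linarith
    then show ?thesis using M n by (simp add: field_simps)
  next
    case False
    then have "f u - h u \<le> 0" using that bdry by auto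
    also have "0 \<le> k * M / n" using k M by simp
    finally show ?thesis .
  qed
  have "M / n / 2 \<le> (\<Sum>v\<in>A. f v - midrange G f v)"
  proof (rule deficit_of_gap[OF _ _ super harm])
    fix v u assume "v \<in> A" "u \<in> neighbours G v" "u \<notin> A"
    then have "f u - h u \<le> k * M / n" "(k + 1) * M / n \<le> f v - h v"
      using below[of u] neighbours_subset by (auto simp: A_def)
    then show "f u - h u + M / n \<le> f v - h v" by (simp add: add_divide_distrib algebra_simps)
  qed (use \<open>v0 \<in> A\<close> in \<open>auto simp: A_def\<close>)
  also have "\<dots> \<le> (\<Sum>v\<in>V. f v - midrange G f v)"
    using super finite_V by (intro sum_mono2) (auto simp: A_def)
  finally show ?thesis using n by (simp add: M_def n_def field_simps)
qed

text \<open>Constants are infinity harmonic and \<open>h\<close> has no deficit, so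
  \<open>deficit_bound\<close>, applied to \<open>h\<close> against the constant \<open>c\<close>,
  allows no excess.\<close>

lemma maximum_principle:
  assumes "infinity_harmonic G V h" "\<And>b. b \<in> B \<Longrightarrow> h b \<le> c" "v \<in> V"
  shows "h v \<le> c"
proof -
  have "infinity_harmonic G V (\<lambda>_. c)"
    unfolding infinity_harmonic_def by (simp add: midrange_const neighbours_nonempty)
  moreover have "superharmonic h" using assms(1) by (auto simp: infinity_harmonic_def)
  ultimately have "h v - c \<le> 2 * real (card V) * (\<Sum>v\<in>V. h v - midrange G h v)"
    using assms by (intro deficit_bound[of h "\<lambda>_. c"]) auto
  also have "(\<Sum>v\<in>V. h v - midrange G h v) = 0"
    using assms(1) by (auto simp: infinity_harmonic_def)
  finally show ?thesis by simp
qed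

end

section \<open>Contraction of the learning dynamics\<close>

lemma lipschitz_learning_cong:
  "(\<And>s. s \<in> {1..t} \<Longrightarrow> v s = w s) \<Longrightarrow> lipschitz_learning G f v t = lipschitz_learning G f w t"
  by (induction t) simp_all

text \<open>Serves to split off the last update from a sum over all update sequences.\<close>

lemma sum_PiE_insert:
  assumes "a \<notin> I"
  shows "(\<Sum>x\<in>Pi\<^sub>E (insert a I) (\<lambda>_. A). F x) = (\<Sum>x\<in>Pi\<^sub>E I (\<lambda>_. A). \<Sum>v\<in>A. F (x(a := v)))"
proof -
  have "(\<Sum>x\<in>Pi\<^sub>E (insert a I) (\<lambda>_. A). F x)
      = (\<Sum>(v, x)\<in>A \<times> Pi\<^sub>E I (\<lambda>_. A). F (x(a := v)))"
    unfolding PiE_insert_eq using inj_combinator[OF assms, of "\<lambda>_. A"]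
    by (simp add: sum.reindex case_prod_unfold)
  also have "\<dots> = (\<Sum>v\<in>A. \<Sum>x\<in>Pi\<^sub>E I (\<lambda>_. A). F (x(a := v)))"
    by (rule sum.cartesian_product[symmetric])
  also have "\<dots> = (\<Sum>x\<in>Pi\<^sub>E I (\<lambda>_. A). \<Sum>v\<in>A. F (x(a := v)))" by (rule sum.swap)
  finally show ?thesis .
qed

section \<open>Supersolutions and comparison of the dynamics\<close>

context connected_boundary_graph
begin

text \<open>A class that is stable under updates and satisfies the hypotheses of
  \<open>deficit_bound\<close>. On it the error has a sign, so its mass is a plain sum.\<close>

definition supersolution :: "('a \<Rightarrow> real) \<Rightarrow> ('a \<Rightarrow> real) \<Rightarrow> bool" where
  "supersolution h p \<longleftrightarrow> superharmonic p \<and> (\<forall>x\<in>V \<union> B. h x \<le> p x) \<and> (\<forall>b\<in>B. p b = h b)"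

text \<open>The update lowers the value at \<open>v\<close>, so midranges at other vertices can only
  drop, while \<open>v\<close>, not being its own neighbour, ends up with deficit zero. The new
  value stays above \<open>h\<close> because the midrange is monotone.\<close>

lemma supersolution_update:
  assumes "infinity_harmonic G V h" "supersolution h p" "v \<in> V"
  shows "supersolution h (p(v := midrange G p v))"
proof -
  let ?q = "p(v := midrange G p v)"
  have p: "superharmonic p" "\<And>x. x \<in> V \<union> B \<Longrightarrow> h x \<le> p x" "\<And>b. b \<in> B \<Longrightarrow> p b = h b"
    using assms(2) by (auto simp: supersolution_def)
  have qp: "?q x \<le> p x" for x using p(1) assms(3) by simp
  have "midrange G ?q u \<le> ?q u" if "u \<in> V" for u
  proof (cases "u = v")
    case True
    have "midrange G ?q v = midrange G p v"
      using not_self_neighbour by (intro midrange_cong) auto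
    then show ?thesis using True by simp
  next
    case False
    have "midrange G ?q u \<le> midrange G p u"
      by (rule midrange_mono[OF finite_neighbours neighbours_nonempty[OF that] qp])
    then show ?thesis using False p(1) that by force
  qed
  moreover have "h v \<le> midrange G p v"
  proof -
    have "h v = midrange G h v" using assms by (simp add: infinity_harmonic_def)
    also have "\<dots> \<le> midrange G p v"
      using p(2) neighbours_subset
      by (intro midrange_mono[OF finite_neighbours neighbours_nonempty[OF assms(3)]]) blast
    finally show ?thesis .
  qed
  moreover have "v \<notin> B" using assms(3) vertex_partition by auto
  ultimately show ?thesis using p unfolding supersolution_def by auto
qed

lemma supersolution_lipschitz_learning:
  assumes "infinity_harmonic G V h" "supersolution h p" "\<And>s. s \<in> {1..t} \<Longrightarrow> v s \<in> V"
  shows "supersolution h (lipschitz_learning G p v t)"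
  using assms(3) by (induction t) (auto intro: supersolution_update assms)

lemma lipschitz_learning_mono:
  assumes "\<And>x. x \<in> V \<union> B \<Longrightarrow> f x \<le> g x" "\<And>s. s \<in> {1..t} \<Longrightarrow> v s \<in> V" "x \<in> V \<union> B"
  shows "lipschitz_learning G f v t x \<le> lipschitz_learning G g v t x"
  using assms(2,3)
proof (induction t arbitrary: x)
  case 0
  then show ?case using assms(1) by simp
next
  case (Suc t)
  have "v (Suc t) \<in> V" using Suc by simp
  have "lipschitz_learning G f v t u \<le> lipschitz_learning G g v t u" if "u \<in> V \<union> B" for u
    using Suc that by simp
  then have "midrange G (lipschitz_learning G f v t) (v (Suc t))
      \<le> midrange G (lipschitz_learning G g v t) (v (Suc t))"
    using neighbours_subset
    by (intro midrange_mono[OF finite_neighbours neighbours_nonempty[OF \<open>v (Suc t) \<in> V\<close>]]) blast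
  then show ?case using Suc by simp
qed

text \<open>Turns the barrier from below into a supersolution for \<open>-h\<close>, so that only
  bounds from above have to be proved.\<close>

lemma lipschitz_learning_uminus:
  assumes "\<And>s. s \<in> {1..t} \<Longrightarrow> v s \<in> V"
  shows "lipschitz_learning G (\<lambda>x. - f x) v t = (\<lambda>x. - lipschitz_learning G f v t x)"
  using assms
proof (induction t)
  case (Suc t)
  then have IH: "lipschitz_learning G (\<lambda>x. - f x) v t = (\<lambda>x. - lipschitz_learning G f v t x)"
    by simp
  have "v (Suc t) \<in> V" using Suc by simp
  then show ?case
    by (auto simp: IH midrange_uminus[OF finite_neighbours neighbours_nonempty])
qed simp

lemma lipschitz_learning_boundary:
  assumes "\<And>s. s \<in> {1..t} \<Longrightarrow> v s \<in> V" "b \<in> B"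
  shows "lipschitz_learning G f v t b = f b"
  using assms(1)
proof (induction t)
  case (Suc t)
  have "v (Suc t) \<in> V" using Suc by simp
  then have "b \<noteq> v (Suc t)" using assms(2) vertex_partition by auto
  then show ?case using Suc by simp
qed simp

section \<open>Contraction of the mass above \<open>h\<close>\<close>

definition error_mass :: "('a \<Rightarrow> real) \<Rightarrow> ('a \<Rightarrow> real) \<Rightarrow> real" where
  "error_mass h p = (\<Sum>x\<in>V. p x - h x)"

text \<open>An update at \<open>v\<close> removes exactly the deficit at \<open>v\<close> from the
  mass. Summed over \<open>v\<close> this removes the total deficit, which by
  \<open>deficit_bound\<close>, summed over the \<open>n\<close> vertices, is at least the mass
  divided by \<open>2 * n ^ 2\<close>.\<close>

lemma error_mass_update_sum:
  assumes harm: "infinity_harmonic G V h" and p: "supersolution h p"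
  shows "(\<Sum>v\<in>V. error_mass h (p(v := midrange G p v)))
    \<le> (real (card V) - 1 / (2 * real (card V) ^ 2)) * error_mass h p"
proof -
  let ?n = "real (card V)" and ?D = "\<Sum>v\<in>V. p v - midrange G p v"
  have n: "?n > 0" using card_V_pos by simp
  have "error_mass h (p(v := midrange G p v)) = error_mass h p - (p v - midrange G p v)"
    if "v \<in> V" for v
  proof -
    have "error_mass h (p(v := midrange G p v))
        = (\<Sum>x\<in>V. (p x - h x) - (if x = v then p v - midrange G p v else 0))"
      unfolding error_mass_def by (intro sum.cong) auto
    then show ?thesis using that finite_V
      by (simp add: sum_subtractf error_mass_def del: sum.cong)
  qed
  then have "(\<Sum>v\<in>V. error_mass h (p(v := midrange G p v)))
      = (\<Sum>v\<in>V. error_mass h p - (p v - midrange G p v))"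
    by (intro sum.cong) auto
  also have "\<dots> = ?n * error_mass h p - ?D" by (simp add: sum_subtractf)
  also have "\<dots> \<le> ?n * error_mass h p - error_mass h p / (2 * ?n ^ 2)"
  proof -
    have "error_mass h p \<le> (\<Sum>x\<in>V. 2 * ?n * ?D)"
      unfolding error_mass_def
      using p by (intro sum_mono deficit_bound[OF _ harm]) (auto simp: supersolution_def)
    then have "error_mass h p \<le> 2 * ?n ^ 2 * ?D" by (simp add: power2_eq_square)
    then show ?thesis using n by (simp add: field_simps)
  qed
  finally show ?thesis by (simp add: algebra_simps)
qed

text \<open>The contraction is iterated for unnormalised sums over all \<open>card V ^ t\<close>
  update sequences; dividing by their number later gives the expectation.\<close>

lemma error_mass_sum_paths:
  assumes harm: "infinity_harmonic G V h" and p: "supersolution h p"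
  shows "(\<Sum>x\<in>{1..t} \<rightarrow>\<^sub>E V. error_mass h (lipschitz_learning G p x t))
    \<le> (real (card V) - 1 / (2 * real (card V) ^ 2)) ^ t * error_mass h p"
proof (induction t)
  case 0
  then show ?case by simp
next
  case (Suc t)
  let ?q = "real (card V) - 1 / (2 * real (card V) ^ 2)"
  have n: "real (card V) \<ge> 1" using card_V_pos by simp
  have "1 \<le> 2 * real (card V) ^ 2" using one_le_power[OF n, of 2] by linarith
  then have "1 / (2 * real (card V) ^ 2) \<le> 1" by (simp add: divide_le_eq)
  then have q: "?q \<ge> 0" using n by linarith
  have "{1..Suc t} = insert (Suc t) {1..t}" by auto
  then have "(\<Sum>x\<in>{1..Suc t} \<rightarrow>\<^sub>E V. error_mass h (lipschitz_learning G p x (Suc t)))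
      = (\<Sum>x\<in>{1..t} \<rightarrow>\<^sub>E V. \<Sum>v\<in>V. error_mass h (lipschitz_learning G p (x(Suc t := v)) (Suc t)))"
    by (simp only: sum_PiE_insert[of "Suc t" "{1..t}"] atLeastAtMost_iff Suc_n_not_le_n simp_thms not_False_eq_True)
  also have "\<dots> \<le> (\<Sum>x\<in>{1..t} \<rightarrow>\<^sub>E V. ?q * error_mass h (lipschitz_learning G p x t))"
  proof (rule sum_mono)
    fix x assume x: "x \<in> {1..t} \<rightarrow>\<^sub>E V"
    have "lipschitz_learning G p (x(Suc t := v)) t = lipschitz_learning G p x t" for v
      by (rule lipschitz_learning_cong) auto
    then have "(\<Sum>v\<in>V. error_mass h (lipschitz_learning G p (x(Suc t := v)) (Suc t)))
        = (\<Sum>v\<in>V. error_mass h ((lipschitz_learning G p x t)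
            (v := midrange G (lipschitz_learning G p x t) v)))"
      by simp
    also have "\<dots> \<le> ?q * error_mass h (lipschitz_learning G p x t)"
      using x by (intro error_mass_update_sum supersolution_lipschitz_learning harm p) auto
    finally show "(\<Sum>v\<in>V. error_mass h (lipschitz_learning G p (x(Suc t := v)) (Suc t)))
        \<le> ?q * error_mass h (lipschitz_learning G p x t)" .
  qed
  also have "\<dots> = ?q * (\<Sum>x\<in>{1..t} \<rightarrow>\<^sub>E V. error_mass h (lipschitz_learning G p x t))"
    by (rule sum_distrib_left[symmetric])
  also have "\<dots> \<le> ?q * (?q ^ t * error_mass h p)" by (rule mult_left_mono[OF Suc q])
  also have "\<dots> = ?q ^ Suc t * error_mass h p" by simp
  finally show ?case .
qed

text \<open>No value exceeds \<open>c\<close>, so neither does a midrange; that this profile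
  dominates \<open>h\<close> is the maximum principle.\<close>

lemma supersolution_constant_interior:
  assumes harm: "infinity_harmonic G V h" and le: "\<And>b. b \<in> B \<Longrightarrow> h b \<le> c"
  shows "supersolution h (\<lambda>x. if x \<in> V then c else h x)"
proof -
  let ?p = "\<lambda>x. if x \<in> V then c else h x"
  have p: "?p x \<le> c" if "x \<in> V \<union> B" for x using that le by auto
  have "midrange G ?p v \<le> ?p v" if "v \<in> V" for v
  proof -
    have "midrange G ?p v \<le> midrange G (\<lambda>_. c) v"
      using p neighbours_subset
      by (intro midrange_mono[OF finite_neighbours neighbours_nonempty[OF that]]) blast
    then show ?thesis using midrange_const[OF neighbours_nonempty[OF that], of c] that by simp
  qed
  moreover have "h x \<le> c" if "x \<in> V" for x by (rule maximum_principle[OF harm le that])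
  ultimately show ?thesis using vertex_partition unfolding supersolution_def by auto
qed

text \<open>The dynamics is squeezed between the two started from the interior values \<open>0\<close> and \<open>1\<close>, whose
  masses relative to \<open>h\<close> add up to the number of interior vertices at time \<open>0\<close>.\<close>

lemma l1_norm_sum_paths:
  assumes ext: "infinity_harmonic_extension G V B f h" and f: "\<And>x. x \<in> V \<union> B \<Longrightarrow> f x \<in> {0..1}"
  shows "(\<Sum>x\<in>{1..t} \<rightarrow>\<^sub>E V. l1_norm G (\<lambda>y. lipschitz_learning G f x t y - h y))
    \<le> (real (card V) - 1 / (2 * real (card V) ^ 2)) ^ t * real (card V)"
proof -
  let ?q = "real (card V) - 1 / (2 * real (card V) ^ 2)"
  define h' where "h' = (\<lambda>x. - h x)"
  define p where "p = (\<lambda>x. if x \<in> V then 1 else h x)"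
  define p' where "p' = (\<lambda>x. if x \<in> V then 0 else h' x)"
  have harm: "infinity_harmonic G V h" and hf: "\<And>b. b \<in> B \<Longrightarrow> h b = f b"
    using ext by (auto simp: infinity_harmonic_extension_def)
  have harm': "infinity_harmonic G V h'"
    using harm
    by (auto simp: infinity_harmonic_def h'_def midrange_uminus[OF finite_neighbours neighbours_nonempty])
  have p: "supersolution h p"
    unfolding p_def using f hf by (intro supersolution_constant_interior harm) auto
  have p': "supersolution h' p'"
    unfolding p'_def using f hf by (intro supersolution_constant_interior harm') (auto simp: h'_def)
  have "l1_norm G (\<lambda>y. lipschitz_learning G f x t y - h y)
      \<le> error_mass h (lipschitz_learning G p x t) + error_mass h' (lipschitz_learning G p' x t)"
    if "x \<in> {1..t} \<rightarrow>\<^sub>E V" for x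
  proof -
    let ?f = "lipschitz_learning G f x t"
    have xV: "x s \<in> V" if "s \<in> {1..t}" for s using that \<open>x \<in> _\<close> by auto
    have up: "?f y \<le> lipschitz_learning G p x t y" if "y \<in> V \<union> B" for y
      using f hf vertex_partition
      by (intro lipschitz_learning_mono[OF _ xV that]) (auto simp: p_def)
    have low: "- ?f y \<le> lipschitz_learning G p' x t y" if "y \<in> V \<union> B" for y
    proof -
      have "lipschitz_learning G (\<lambda>y. - f y) x t y \<le> lipschitz_learning G p' x t y"
        using f hf vertex_partition
        by (intro lipschitz_learning_mono[OF _ xV that]) (auto simp: p'_def h'_def)
      then show ?thesis using lipschitz_learning_uminus[OF xV, where f = f] by simp
    qed
    have sp: "h y \<le> lipschitz_learning G p x t y" "h' y \<le> lipschitz_learning G p' x t y"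
      if "y \<in> V \<union> B" for y
      using supersolution_lipschitz_learning[OF harm p xV]
        supersolution_lipschitz_learning[OF harm' p' xV] that by (auto simp: supersolution_def)
    have "l1_norm G (\<lambda>y. ?f y - h y) = (\<Sum>y\<in>V. \<bar>?f y - h y\<bar>) + (\<Sum>y\<in>B. \<bar>?f y - h y\<bar>)"
      unfolding l1_norm_def vertex_partition(1)
      by (rule sum.union_disjoint[OF finite_V finite_B vertex_partition(2)])
    also have "(\<Sum>y\<in>B. \<bar>?f y - h y\<bar>) = 0"
      using lipschitz_learning_boundary[OF xV] hf by simp
    also have "(\<Sum>y\<in>V. \<bar>?f y - h y\<bar>) + 0 \<le> (\<Sum>y\<in>V.
        (lipschitz_learning G p x t y - h y) + (lipschitz_learning G p' x t y - h' y))"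
    \<comment> \<open>Both terms on the right are nonnegative; the first bounds the error from
      above, the second its negative.\<close>
    proof (simp, rule sum_mono)
      fix y assume "y \<in> V"
      then show "\<bar>?f y - h y\<bar>
          \<le> (lipschitz_learning G p x t y - h y) + (lipschitz_learning G p' x t y - h' y)"
        using up[of y] low[of y] sp[of y] by (simp add: h'_def abs_le_iff)
    qed
    also have "\<dots> = error_mass h (lipschitz_learning G p x t)
        + error_mass h' (lipschitz_learning G p' x t)"
      by (simp add: error_mass_def sum.distrib)
    finally show ?thesis .
  qed
  then have "(\<Sum>x\<in>{1..t} \<rightarrow>\<^sub>E V. l1_norm G (\<lambda>y. lipschitz_learning G f x t y - h y))
      \<le> (\<Sum>x\<in>{1..t} \<rightarrow>\<^sub>E V. error_mass h (lipschitz_learning G p x t)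
        + error_mass h' (lipschitz_learning G p' x t))"
    by (rule sum_mono)
  also have "\<dots> \<le> ?q ^ t * error_mass h p + ?q ^ t * error_mass h' p'"
    unfolding sum.distrib
    by (intro add_mono error_mass_sum_paths harm harm' p p')
  also have "\<dots> = ?q ^ t * (error_mass h p + error_mass h' p')" by (simp add: algebra_simps)
  also have "error_mass h p + error_mass h' p' = real (card V)"
    by (simp add: error_mass_def p_def p'_def h'_def flip: sum.distrib)
  finally show ?thesis .
qed

end

section \<open>Hitting times\<close>

text \<open>The first \<open>N\<close> terms are bounded by \<open>1\<close>, the rest is geometric.
  Rounding \<open>T\<close> up to \<open>N\<close> costs \<open>\<delta>\<close> in the head, and
  convexity of \<open>exp\<close> shows that the later start of the tail regains it. This keeps the
  additive constant at \<open>1\<close>.\<close>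

lemma exp_tail_sums:
  fixes a T :: real
  assumes a: "a > 0" and T: "T \<ge> 0"
  shows "\<exists>S. (\<lambda>t. min 1 (exp (- (real t - T) / a))) sums S \<and> S \<le> 1 + T + a"
proof -
  define N where "N = nat \<lceil>T\<rceil>"
  define \<delta> where "\<delta> = real N - T"
  define r where "r = exp (- 1 / a)"
  have N: "real N = of_int \<lceil>T\<rceil>" using T by (simp add: N_def)
  have \<delta>: "0 \<le> \<delta>" "\<delta> \<le> 1" unfolding \<delta>_def N by linarith+
  have r: "0 < r" "r < 1" using a by (auto simp: r_def)
  let ?q = "\<lambda>t. min 1 (exp (- (real t - T) / a))"
  have tail: "?q (t + N) = exp (- \<delta> / a) * r ^ t" for t
  proof -
    have "- (real (t + N) - T) / a = - \<delta> / a + real t * (- 1 / a)"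
      using a by (simp add: \<delta>_def field_simps)
    then have "exp (- (real (t + N) - T) / a) = exp (- \<delta> / a) * r ^ t"
      by (simp only: exp_add r_def exp_of_nat_mult)
    moreover have "- (real (t + N) - T) / a \<le> 0" using a \<delta> by (simp add: \<delta>_def divide_le_0_iff)
    then have "exp (- (real (t + N) - T) / a) \<le> 1" by simp
    ultimately show ?thesis by simp
  qed
  have "(\<lambda>t. exp (- \<delta> / a) * r ^ t) sums (exp (- \<delta> / a) * (1 / (1 - r)))"
    using r by (intro sums_mult geometric_sums) auto
  then have "(\<lambda>t. ?q (t + N)) sums (exp (- \<delta> / a) * (1 / (1 - r)))" by (simp only: tail)
  then have sums: "?q sums (exp (- \<delta> / a) * (1 / (1 - r)) + (\<Sum>t<N. ?q t))"
    by (rule sums_iff_shift[THEN iffD1])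
  have "(\<Sum>t<N. ?q t) \<le> (\<Sum>t<N. 1)" by (rule sum_mono) simp
  then have head: "(\<Sum>t<N. ?q t) \<le> T + \<delta>" by (simp add: \<delta>_def)
  \<comment> \<open>convexity of \<open>exp\<close> on the segment from \<open>0\<close> to \<open>- 1 / a\<close>\<close>
  have "exp (- \<delta> / a) \<le> 1 - \<delta> * (1 - r)"
  proof -
    have "exp ((1 - \<delta>) *\<^sub>R 0 + \<delta> *\<^sub>R (- 1 / a)) \<le> (1 - \<delta>) * exp 0 + \<delta> * exp (- 1 / a)"
      using \<delta> by (intro convex_onD[OF exp_convex]) auto
    then show ?thesis by (simp add: r_def algebra_simps)
  qed
  then have "exp (- \<delta> / a) / (1 - r) \<le> (1 - \<delta> * (1 - r)) / (1 - r)"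
    using r by (intro divide_right_mono) auto
  also have "\<dots> = 1 / (1 - r) - \<delta>" using r by (simp add: field_simps)
  also have "1 / (1 - r) \<le> 1 + a"
  proof -
    have "1 + 1 / a \<le> exp (1 / a)" by (rule exp_ge_add_one_self)
    then have "(1 + 1 / a) * r \<le> exp (1 / a) * r" using r by (intro mult_right_mono) auto
    also have "exp (1 / a) * r = 1" by (simp add: r_def flip: exp_add)
    finally have "(a + 1) * r \<le> a" using a by (simp add: field_simps)
    then show ?thesis using r by (simp add: field_simps)
  qed
  finally have "exp (- \<delta> / a) * (1 / (1 - r)) \<le> 1 + a - \<delta>" by simp
  then have "exp (- \<delta> / a) * (1 / (1 - r)) + (\<Sum>t<N. ?q t) \<le> 1 + T + a" using head by linarith
  then show ?thesis using sums by blast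
qed

lemma Inf_enat_image_eq_iff: "Inf (enat ` T) = enat t \<longleftrightarrow> t \<in> T \<and> (\<forall>s<t. s \<notin> T)"
proof
  assume *: "Inf (enat ` T) = enat t"
  then have "enat ` T \<noteq> {}" by (auto simp: Inf_enat_def)
  then have "Inf (enat ` T) \<in> enat ` T" unfolding Inf_enat_def by (auto intro: LeastI)
  then have "t \<in> T" using * by auto
  moreover have "t \<le> s" if "s \<in> T" for s
    using Inf_lower[of "enat s" "enat ` T"] that * by simp
  ultimately show "t \<in> T \<and> (\<forall>s<t. s \<notin> T)" by (meson not_less)
next
  assume "t \<in> T \<and> (\<forall>s<t. s \<notin> T)"
  then have "t \<in> T" "\<And>s. s \<in> T \<Longrightarrow> t \<le> s" by (meson not_less)+
  then show "Inf (enat ` T) = enat t"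
    by (intro antisym Inf_lower Inf_greatest) auto
qed

lemma Inf_enat_image_eq_infinity_iff: "Inf (enat ` T) = \<infinity> \<longleftrightarrow> T = {}"
proof
  show "T = {}" if "Inf (enat ` T) = \<infinity>"
    using that Inf_lower[of _ "enat ` T"] by fastforce
qed (simp add: Inf_enat_def)

text \<open>The type \<open>enat\<close> is countable, so singletons suffice: a finite value means a
  first success at that time, infinity means no success at all.\<close>

lemma measurable_hitting_time:
  assumes [measurable]: "\<And>t. Measurable.pred M (P t)"
  shows "(\<lambda>\<omega>. Inf (enat ` {t. P t \<omega>})) \<in> measurable M (count_space UNIV)"
proof (subst measurable_count_space_eq2_countable, intro conjI ballI)
  fix e :: enat
  show "(\<lambda>\<omega>. Inf (enat ` {t. P t \<omega>})) -` {e} \<inter> space M \<in> sets M"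
  proof (cases e)
    case (enat t)
    then have "(\<lambda>\<omega>. Inf (enat ` {t. P t \<omega>})) -` {e} \<inter> space M
        = {\<omega>\<in>space M. P t \<omega> \<and> (\<forall>s\<in>{..<t}. \<not> P s \<omega>)}"
      by (auto simp: Inf_enat_image_eq_iff)
    then show ?thesis by simp
  next
    case infinity
    then have "(\<lambda>\<omega>. Inf (enat ` {t. P t \<omega>})) -` {e} \<inter> space M = {\<omega>\<in>space M. \<forall>t. \<not> P t \<omega>}"
      unfolding infinity by (auto simp only: Inf_enat_image_eq_infinity_iff vimage_def)
    then show ?thesis by simp
  qed
qed auto

lemma less_approximation_timeD:
  "enat t < approximation_time G f h v \<epsilon> \<Longrightarrow>
    \<epsilon> < sup_norm G (\<lambda>x. lipschitz_learning G f v t x - h x)"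
  unfolding approximation_time_def
  by (metis (mono_tags, lifting) Inf_lower image_eqI mem_Collect_eq not_le)

lemma sup_norm_le_l1_norm:
  assumes "finite (pverts G)" "pverts G \<noteq> {}"
  shows "sup_norm G g \<le> l1_norm G g"
  unfolding sup_norm_def l1_norm_def using assms
  by (intro Max.boundedI) (auto intro: member_le_sum)

section \<open>Independent uniform updates\<close>

text \<open>Independence multiplies the \<open>t\<close> single probabilities
  \<open>1 / card V\<close>: the first \<open>t\<close> updates are uniform on the sequences over
  \<open>V\<close>.\<close>

lemma (in prob_space) iid_uniform_updates_path:
  assumes iid: "iid_uniform_updates M V X" and V: "finite V" and x: "x \<in> {1..t} \<rightarrow>\<^sub>E V"
  shows "{\<omega>\<in>space M. \<forall>s\<in>{1..t}. X s \<omega> = x s} \<in> events"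
    and "prob {\<omega>\<in>space M. \<forall>s\<in>{1..t}. X s \<omega> = x s} = 1 / real (card V) ^ t"
proof -
  have indep: "indep_vars (\<lambda>_. count_space V) X {1..}"
    and unif: "\<And>s. s \<ge> 1 \<Longrightarrow> distr M (count_space V) (X s) = uniform_count_measure V"
    using iid by (auto simp: iid_uniform_updates_def)
  have meas: "X s \<in> measurable M (count_space V)" if "s \<ge> 1" for s
    using indep that by (auto simp: indep_vars_def)
  have single: "X s -` {x s} \<inter> space M \<in> events" "prob (X s -` {x s} \<inter> space M) = 1 / real (card V)"
    if "s \<in> {1..t}" for s
  proof -
    have s: "s \<ge> 1" "x s \<in> V" using that x by auto
    show "X s -` {x s} \<inter> space M \<in> events"
      using measurable_sets[OF meas[OF s(1)], of "{x s}"] s by simp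
    have "prob (X s -` {x s} \<inter> space M) = measure (distr M (count_space V) (X s)) {x s}"
      using s meas by (intro measure_distr[symmetric]) auto
    also have "\<dots> = 1 / real (card V)"
      using s V by (simp add: unif measure_uniform_count_measure)
    finally show "prob (X s -` {x s} \<inter> space M) = 1 / real (card V)" .
  qed
  have "{\<omega>\<in>space M. \<forall>s\<in>{1..t}. X s \<omega> = x s} \<in> events \<and>
      prob {\<omega>\<in>space M. \<forall>s\<in>{1..t}. X s \<omega> = x s} = 1 / real (card V) ^ t"
  proof (cases "t = 0")
    \<comment> \<open>The intersection over an empty index set would be \<open>UNIV\<close> instead
      of \<open>space M\<close>.\<close>
    case True
    then show ?thesis by (simp add: prob_space)
  next
    case False
    then have eq: "{\<omega>\<in>space M. \<forall>s\<in>{1..t}. X s \<omega> = x s}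
        = (\<Inter>s\<in>{1..t}. X s -` {x s} \<inter> space M)" by auto
    have "prob (\<Inter>s\<in>{1..t}. X s -` {x s} \<inter> space M)
        = (\<Prod>s\<in>{1..t}. prob (X s -` {x s} \<inter> space M))"
      using False x by (intro indep_varsD[OF indep]) auto
    also have "\<dots> = (\<Prod>s\<in>{1..t}. 1 / real (card V))" by (intro prod.cong refl single)
    also have "\<dots> = 1 / real (card V) ^ t" by (simp add: power_one_over)
    finally have "prob (\<Inter>s\<in>{1..t}. X s -` {x s} \<inter> space M) = 1 / real (card V) ^ t" .
    moreover have "(\<Inter>s\<in>{1..t}. X s -` {x s} \<inter> space M) \<in> events"
      using False single by (intro sets.finite_INT) auto
    ultimately show ?thesis unfolding eq by blast
  qed
  then show "{\<omega>\<in>space M. \<forall>s\<in>{1..t}. X s \<omega> = x s} \<in> events"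
    and "prob {\<omega>\<in>space M. \<forall>s\<in>{1..t}. X s \<omega> = x s} = 1 / real (card V) ^ t" by auto
qed

text \<open>Since \<open>F\<close> sees only the first \<open>t\<close> updates, it is a finite
  combination of indicators of path events. This yields integrability and turns the expectation into
  an average over sequences.\<close>

lemma (in prob_space) iid_uniform_updates_expectation:
  fixes F :: "(nat \<Rightarrow> 'b) \<Rightarrow> real"
  assumes iid: "iid_uniform_updates M V X" and V: "finite V"
    and F: "\<And>x y. (\<And>s. s \<in> {1..t} \<Longrightarrow> x s = y s) \<Longrightarrow> F x = F y"
  shows "integrable M (\<lambda>\<omega>. F (\<lambda>s. X s \<omega>))"
    and "expectation (\<lambda>\<omega>. F (\<lambda>s. X s \<omega>)) = (\<Sum>x\<in>{1..t} \<rightarrow>\<^sub>E V. F x) / real (card V) ^ t"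
proof -
  define E where "E x = {\<omega>\<in>space M. \<forall>s\<in>{1..t}. X s \<omega> = x s}" for x
  have XV: "X s \<omega> \<in> V" if "s \<in> {1..t}" "\<omega> \<in> space M" for s \<omega>
  proof -
    have "X s \<in> measurable M (count_space V)"
      using iid that by (auto simp: iid_uniform_updates_def indep_vars_def)
    then show ?thesis using measurable_space[of "X s" M "count_space V" \<omega>] that by simp
  qed
  have fin: "finite ({1..t} \<rightarrow>\<^sub>E V)" using V by (intro finite_PiE) auto
  have ev: "E x \<in> events" "prob (E x) = 1 / real (card V) ^ t" if "x \<in> {1..t} \<rightarrow>\<^sub>E V" for x
    using iid_uniform_updates_path[OF iid V that] by (auto simp: E_def)
  have rep: "F (\<lambda>s. X s \<omega>) = (\<Sum>x\<in>{1..t} \<rightarrow>\<^sub>E V. F x * indicator (E x) \<omega>)"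
    if \<omega>: "\<omega> \<in> space M" for \<omega>
  proof -
    let ?x = "\<lambda>s\<in>{1..t}. X s \<omega>"
    have x: "?x \<in> {1..t} \<rightarrow>\<^sub>E V" using XV \<omega> by auto
    have "indicator (E y) \<omega> = (if y = ?x then 1 else (0::real))" if "y \<in> {1..t} \<rightarrow>\<^sub>E V" for y
    proof -
      have "\<omega> \<in> E y \<longleftrightarrow> y = ?x"
      proof
        assume "\<omega> \<in> E y"
        then show "y = ?x" using that by (intro PiE_ext[OF that x]) (auto simp: E_def)
      qed (use \<omega> in \<open>auto simp: E_def\<close>)
      then show ?thesis by (simp add: indicator_def)
    qed
    then have "(\<Sum>x\<in>{1..t} \<rightarrow>\<^sub>E V. F x * indicator (E x) \<omega>)
        = (\<Sum>y\<in>{1..t} \<rightarrow>\<^sub>E V. if y = ?x then F y else 0)"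
      by (intro sum.cong) auto
    also have "\<dots> = F ?x" using x fin by simp
    \<comment> \<open>The restricted sequence is \<open>undefined\<close> outside
      \<open>{1..t}\<close>, where \<open>F\<close> does not look.\<close>
    also have "F ?x = F (\<lambda>s. X s \<omega>)" by (rule F) simp
    finally show ?thesis by simp
  qed
  have int: "integrable M (\<lambda>\<omega>. F x * indicator (E x) \<omega>)" if "x \<in> {1..t} \<rightarrow>\<^sub>E V" for x
    using ev[OF that] by (intro integrable_mult_right) (auto simp: emeasure_eq_measure)
  have "integrable M (\<lambda>\<omega>. \<Sum>x\<in>{1..t} \<rightarrow>\<^sub>E V. F x * indicator (E x) \<omega>)"
    using int by (rule Bochner_Integration.integrable_sum)
  then show "integrable M (\<lambda>\<omega>. F (\<lambda>s. X s \<omega>))"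
    by (subst Bochner_Integration.integrable_cong[OF refl rep]) auto
  have "expectation (\<lambda>\<omega>. F (\<lambda>s. X s \<omega>))
      = expectation (\<lambda>\<omega>. \<Sum>x\<in>{1..t} \<rightarrow>\<^sub>E V. F x * indicator (E x) \<omega>)"
    by (rule Bochner_Integration.integral_cong[OF refl rep])
  also have "\<dots> = (\<Sum>x\<in>{1..t} \<rightarrow>\<^sub>E V. expectation (\<lambda>\<omega>. F x * indicator (E x) \<omega>))"
    using int by (rule Bochner_Integration.integral_sum)
  also have "\<dots> = (\<Sum>x\<in>{1..t} \<rightarrow>\<^sub>E V. F x / real (card V) ^ t)"
    using ev by (intro sum.cong refl) (simp add: Int_absorb1 sets.sets_into_space)
  finally show "expectation (\<lambda>\<omega>. F (\<lambda>s. X s \<omega>)) = (\<Sum>x\<in>{1..t} \<rightarrow>\<^sub>E V. F x) / real (card V) ^ t"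
    by (simp add: sum_divide_distrib)
qed

section \<open>Expected error and expected approximation time\<close>

context connected_boundary_graph
begin

lemma expected_l1_error:
  assumes ext: "infinity_harmonic_extension G V B f h" and f: "\<And>x. x \<in> V \<union> B \<Longrightarrow> f x \<in> {0..1}"
    and M: "prob_space M" and iid: "iid_uniform_updates M V X"
  shows "integrable M (\<lambda>\<omega>. l1_norm G (\<lambda>x. lipschitz_learning G f (\<lambda>s. X s \<omega>) t x - h x))"
    and "(\<integral>\<omega>. l1_norm G (\<lambda>x. lipschitz_learning G f (\<lambda>s. X s \<omega>) t x - h x) \<partial>M)
      \<le> real (card V) * exp (- real t / (2 * real (card V) ^ 3))"
proof -
  interpret prob_space M by (rule M)
  let ?n = "real (card V)"
  define F where "F v = l1_norm G (\<lambda>x. lipschitz_learning G f v t x - h x)" for v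
  have F: "F v = F w" if "\<And>s. s \<in> {1..t} \<Longrightarrow> v s = w s" for v w
    unfolding F_def using lipschitz_learning_cong[OF that, where t = t] by simp
  have n: "?n \<ge> 1" using card_V_pos by simp
  show "integrable M (\<lambda>\<omega>. l1_norm G (\<lambda>x. lipschitz_learning G f (\<lambda>s. X s \<omega>) t x - h x))"
    using iid_uniform_updates_expectation(1)[where F = F and t = t, OF iid finite_V F] by (simp add: F_def)
  have "(\<integral>\<omega>. F (\<lambda>s. X s \<omega>) \<partial>M) = (\<Sum>x\<in>{1..t} \<rightarrow>\<^sub>E V. F x) / ?n ^ t"
    by (rule iid_uniform_updates_expectation(2)[where F = F and t = t, OF iid finite_V F])
  also have "\<dots> \<le> (?n - 1 / (2 * ?n ^ 2)) ^ t * ?n / ?n ^ t"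
    using l1_norm_sum_paths[OF ext f] by (intro divide_right_mono) (auto simp: F_def)
  \<comment> \<open>Normalising by the number of sequences turns the factor of the sums into
    \<open>1 - 1 / (2 * ?n ^ 3)\<close> per step.\<close>
  also have "\<dots> = ?n * ((?n - 1 / (2 * ?n ^ 2)) / ?n) ^ t" by (simp add: power_divide)
  also have "(?n - 1 / (2 * ?n ^ 2)) / ?n = 1 - 1 / (2 * ?n ^ 3)"
    using n by (simp add: field_simps power2_eq_square power3_eq_cube)
  also have "?n * (1 - 1 / (2 * ?n ^ 3)) ^ t \<le> ?n * exp (- 1 / (2 * ?n ^ 3)) ^ t"
  proof (intro mult_left_mono power_mono)
    show "1 - 1 / (2 * ?n ^ 3) \<le> exp (- 1 / (2 * ?n ^ 3))"
      using exp_ge_add_one_self[of "- 1 / (2 * ?n ^ 3)"] by simp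
    have "1 \<le> 2 * ?n ^ 3" using one_le_power[OF n, of 3] by linarith
    then show "0 \<le> 1 - 1 / (2 * ?n ^ 3)" by (simp add: divide_le_eq)
  qed simp
  also have "exp (- 1 / (2 * ?n ^ 3)) ^ t = exp (- real t / (2 * ?n ^ 3))"
    by (simp flip: exp_of_nat_mult)
  finally show "(\<integral>\<omega>. l1_norm G (\<lambda>x. lipschitz_learning G f (\<lambda>s. X s \<omega>) t x - h x) \<partial>M)
      \<le> ?n * exp (- real t / (2 * ?n ^ 3))"
    by (simp only: F_def)
qed

lemma measurable_approximation_time:
  assumes M: "prob_space M" and iid: "iid_uniform_updates M V X"
  shows "(\<lambda>\<omega>. approximation_time G f h (\<lambda>s. X s \<omega>) \<epsilon>) \<in> measurable M (count_space UNIV)"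
  unfolding approximation_time_def
proof (rule measurable_hitting_time)
  interpret prob_space M by (rule M)
  fix t
  define F where "F v = sup_norm G (\<lambda>x. lipschitz_learning G f v t x - h x)" for v
  have F: "F v = F w" if "\<And>s. s \<in> {1..t} \<Longrightarrow> v s = w s" for v w
    unfolding F_def using lipschitz_learning_cong[OF that, where t = t] by simp
  have [measurable]: "(\<lambda>\<omega>. F (\<lambda>s. X s \<omega>)) \<in> borel_measurable M"
    using iid_uniform_updates_expectation(1)[where F = F and t = t, OF iid finite_V F] by (rule borel_measurable_integrable)
  have "Measurable.pred M (\<lambda>\<omega>. F (\<lambda>s. X s \<omega>) \<le> \<epsilon>)" by measurable
  then show "Measurable.pred M
      (\<lambda>\<omega>. sup_norm G (\<lambda>x. lipschitz_learning G f (\<lambda>s. X s \<omega>) t x - h x) \<le> \<epsilon>)"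
    by (simp only: F_def)
qed

text \<open>The expectation of the time is the sum of its tail probabilities. Before that time the
  sup norm, hence the \<open>\<ell>1\<close> norm, exceeds \<open>\<epsilon>\<close>, so Markov's
  inequality bounds each tail.\<close>

lemma expected_approximation_time:
  assumes ext: "infinity_harmonic_extension G V B f h" and f: "\<And>x. x \<in> V \<union> B \<Longrightarrow> f x \<in> {0..1}"
    and M: "prob_space M" and iid: "iid_uniform_updates M V X" and \<epsilon>: "0 < \<epsilon>" "\<epsilon> < 1"
  shows "(\<integral>\<^sup>+\<omega>. ennreal_of_enat (approximation_time G f h (\<lambda>s. X s \<omega>) \<epsilon>) \<partial>M)
    \<le> ennreal (1 + 2 * real (card V) ^ 3 * ln (real (card V) * exp 1 / \<epsilon>))"
proof -
  interpret prob_space M by (rule M)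
  let ?n = "real (card V)"
  let ?\<tau> = "\<lambda>\<omega>. approximation_time G f h (\<lambda>s. X s \<omega>) \<epsilon>"
  \<comment> \<open>At time \<open>T\<close> the Markov bound
    \<open>?n / \<epsilon> * exp (- t / a)\<close> equals \<open>1\<close>; the extra
    \<open>a\<close> from \<open>exp_tail_sums\<close> becomes the factor \<open>e\<close> inside
    the logarithm.\<close>
  define a T where "a = 2 * ?n ^ 3" and "T = a * ln (?n / \<epsilon>)"
  have n: "?n \<ge> 1" using card_V_pos by simp
  then have a: "a > 0" by (simp add: a_def)
  have "?n / \<epsilon> \<ge> 1" using n \<epsilon> by simp
  then have T: "T \<ge> 0" using a by (simp add: T_def)
  let ?q = "\<lambda>t. min 1 (exp (- (real t - T) / a))"
  have tail: "emeasure M {\<omega>\<in>space M. enat t < ?\<tau> \<omega>} \<le> ennreal (?q t)" for t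
  proof -
    let ?err = "\<lambda>\<omega>. l1_norm G (\<lambda>x. lipschitz_learning G f (\<lambda>s. X s \<omega>) t x - h x)"
    have int: "integrable M ?err" by (rule expected_l1_error(1)[OF ext f M iid])
    then have [measurable]: "?err \<in> borel_measurable M" by (rule borel_measurable_integrable)
    have pv: "pverts G \<noteq> {}" using vertex_partition interior_nonempty by auto
    have "emeasure M {\<omega>\<in>space M. enat t < ?\<tau> \<omega>} \<le> emeasure M {\<omega>\<in>space M. \<epsilon> \<le> ?err \<omega>}"
    proof (rule emeasure_mono)
      show "{\<omega>\<in>space M. enat t < ?\<tau> \<omega>} \<subseteq> {\<omega>\<in>space M. \<epsilon> \<le> ?err \<omega>}"
      proof safe
        fix \<omega> assume "enat t < ?\<tau> \<omega>"
        from less_approximation_timeD[OF this]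
        show "\<epsilon> \<le> ?err \<omega>"
          using sup_norm_le_l1_norm[OF pair_finite_verts pv] by (meson less_imp_le order_trans)
      qed
    qed measurable
    also have "\<dots> \<le> ennreal ((1 / \<epsilon>) * (\<integral>\<omega>. ?err \<omega> \<partial>M))"
      using int \<epsilon> by (intro integral_Markov_inequality) (auto simp: l1_norm_def sum_nonneg)
    also have "\<dots> \<le> ennreal (exp (- (real t - T) / a))"
    proof (rule ennreal_leI)
      have "(1 / \<epsilon>) * (\<integral>\<omega>. ?err \<omega> \<partial>M) \<le> (1 / \<epsilon>) * (?n * exp (- real t / (2 * ?n ^ 3)))"
        using \<epsilon> by (intro mult_left_mono expected_l1_error(2)[OF ext f M iid]) auto
      also have "\<dots> = exp (ln (?n / \<epsilon>)) * exp (- real t / a)"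
        using n \<epsilon> by (simp add: a_def)
      also have "\<dots> = exp (- (real t - T) / a)"
        using a by (simp add: T_def diff_divide_distrib flip: exp_add)
      finally show "(1 / \<epsilon>) * (\<integral>\<omega>. ?err \<omega> \<partial>M) \<le> exp (- (real t - T) / a)" .
    qed
    finally have "emeasure M {\<omega>\<in>space M. enat t < ?\<tau> \<omega>} \<le> ennreal (exp (- (real t - T) / a))" .
    moreover have "emeasure M {\<omega>\<in>space M. enat t < ?\<tau> \<omega>} \<le> ennreal 1"
      by (simp add: emeasure_eq_measure)
    ultimately show ?thesis by (simp add: min_def)
  qed
  obtain S where S: "?q sums S" "S \<le> 1 + T + a" using exp_tail_sums[OF a T] by blast
  have "(\<integral>\<^sup>+\<omega>. ennreal_of_enat (?\<tau> \<omega>) \<partial>M) = (\<Sum>t. emeasure M {\<omega>\<in>space M. enat t < ?\<tau> \<omega>})"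
    by (rule nn_integral_enat_function[OF measurable_approximation_time[OF M iid]])
  also have "\<dots> \<le> (\<Sum>t. ennreal (?q t))" using tail by (intro suminf_le) auto
  also have "\<dots> = ennreal S" using S(1) by (intro suminf_ennreal_eq) auto
  also have "\<dots> \<le> ennreal (1 + T + a)" using S(2) by (rule ennreal_leI)
  also have "1 + T + a = 1 + 2 * ?n ^ 3 * ln (?n * exp 1 / \<epsilon>)"
  proof -
    have "ln (?n * exp 1 / \<epsilon>) = ln (?n / \<epsilon>) + 1"
      using n \<epsilon> ln_mult_pos[of "?n / \<epsilon>" "exp 1"] by simp
    then show ?thesis by (simp add: T_def a_def algebra_simps)
  qed
  finally show ?thesis .
qed

end

section \<open>The segment\<close>

lemma midrange_segment:
  assumes "i \<in> segment_interior n"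
  shows "midrange (segment_graph n) f i = (f (i - 1) + f (i + 1)) / 2"
proof -
  have i: "1 \<le> i" "i < n" using assms by (auto simp: segment_interior_def)
  then have "neighbours (segment_graph n) i = {i - 1, i + 1}"
    by (auto simp: neighbours_def segment_graph_def)
  then show ?thesis by (simp add: midrange_def max_def min_def)
qed

text \<open>The leftmost minimiser of \<open>h\<close> is an endpoint, since averaging at an
  interior minimiser makes its left neighbour a minimiser too.\<close>

lemma segment_harmonic_ge_1:
  assumes h: "infinity_harmonic_extension (segment_graph n) (segment_interior n)
      (segment_boundary n) (segment_profile n) h" and "i \<le> n"
  shows "1 \<le> h i"
proof -
  have bdry: "h 0 = 1" "h n = 1"
    using h by (auto simp: infinity_harmonic_extension_def segment_boundary_def segment_profile_def)
  have harm: "h j = (h (j - 1) + h (j + 1)) / 2" if "1 \<le> j" "j < n" for j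
  proof -
    have "j \<in> segment_interior n" using that by (auto simp: segment_interior_def)
    then show ?thesis using h midrange_segment[of j n h]
      by (auto simp: infinity_harmonic_extension_def infinity_harmonic_def)
  qed
  define m where "m = Min (h ` {..n})"
  have m: "m \<le> h j" if "j \<le> n" for j using that by (simp add: m_def)
  have "m \<in> h ` {..n}" unfolding m_def by (intro Min_in) auto
  then have ex: "\<exists>j. j \<le> n \<and> h j = m" by auto
  define k where "k = (LEAST j. j \<le> n \<and> h j = m)"
  have k: "k \<le> n" "h k = m" using LeastI_ex[OF ex] by (auto simp: k_def)
  have "k = 0 \<or> k = n"
  proof (rule ccontr)
    assume "\<not> ?thesis"
    then have "1 \<le> k" "k < n" using k by auto
    then have "h (k - 1) = m" using harm[of k] m[of "k - 1"] m[of "k + 1"] k by force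
    then have "k \<le> k - 1" unfolding k_def using k(1) by (intro Least_le) (simp add: k_def)
    then show False using \<open>1 \<le> k\<close> by simp
  qed
  then show ?thesis using bdry k m[OF \<open>i \<le> n\<close>] by auto
qed

text \<open>The invariant of the dynamics. Convexity makes every update an increase and the slopes
  monotone, which together with the range \<open>[0, 1]\<close> bounds the slopes by the distance to
  the ends.\<close>

definition convex_profile :: "nat \<Rightarrow> (nat \<Rightarrow> real) \<Rightarrow> bool" where
  "convex_profile n f \<longleftrightarrow> f 0 = 1 \<and> f n = 1 \<and> (\<forall>i\<le>n. 0 \<le> f i \<and> f i \<le> 1) \<and>
     (\<forall>i. 1 \<le> i \<and> i < n \<longrightarrow> 2 * f i \<le> f (i - 1) + f (i + 1))"

lemma convex_profileD:
  "convex_profile n f \<Longrightarrow> 1 \<le> i \<Longrightarrow> i < n \<Longrightarrow> f i \<le> (f (i - 1) + f (i + 1)) / 2"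
  unfolding convex_profile_def by (metis le_divide_eq_numeral1(1) mult.commute)

lemma convex_profile_segment: "n \<ge> 2 \<Longrightarrow> convex_profile n (segment_profile n)"
  by (auto simp: convex_profile_def segment_profile_def segment_boundary_def)

lemma convex_profile_update:
  assumes f: "convex_profile n f" and i: "1 \<le> i" "i < n"
  shows "convex_profile n (f(i := (f (i - 1) + f (i + 1)) / 2))"
proof -
  let ?g = "f(i := (f (i - 1) + f (i + 1)) / 2)"
  have fg: "f j \<le> ?g j" for j using convex_profileD[OF f i] by simp
  have "2 * ?g j \<le> ?g (j - 1) + ?g (j + 1)" if "1 \<le> j" "j < n" for j
  proof (cases "j = i")
    case True
    then show ?thesis using i by auto
  next
    case False
    then have "2 * ?g j \<le> f (j - 1) + f (j + 1)" using f that by (simp add: convex_profile_def)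
    then show ?thesis using fg[of "j - 1"] fg[of "j + 1"] by linarith
  qed
  moreover have "0 \<le> f (i - 1)" "f (i - 1) \<le> 1" "0 \<le> f (i + 1)" "f (i + 1) \<le> 1"
    using f i by (auto simp: convex_profile_def)
  then have "0 \<le> ?g j \<and> ?g j \<le> 1" if "j \<le> n" for j
    using f that by (auto simp: convex_profile_def)
  moreover have "?g 0 = 1" "?g n = 1" using f i by (auto simp: convex_profile_def)
  ultimately show ?thesis unfolding convex_profile_def by blast
qed

lemma convex_profile_slope_mono:
  assumes f: "convex_profile n f" and "i \<le> j" "j < n"
  shows "f (Suc i) - f i \<le> f (Suc j) - f j"
  using assms(2,3)
proof (induction j rule: dec_induct)
  case (step j)
  have "2 * f (Suc j) \<le> f (Suc j - 1) + f (Suc j + 1)"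
    using f step by (simp only: convex_profile_def) auto
  then show ?case using step by simp
qed simp

text \<open>All slopes to the right of the edge are at least as large, and the total rise up to
  \<open>n\<close> is at most \<open>1\<close>.\<close>

lemma convex_profile_slope_le:
  assumes f: "convex_profile n f" and i: "i < n"
  shows "(real n - real i) * (f (Suc i) - f i) \<le> 1"
proof -
  have "f i + real k * (f (Suc i) - f i) \<le> f (i + k)" if "i + k \<le> n" for k
    using that
  proof (induction k)
    case (Suc k)
    then show ?case using convex_profile_slope_mono[OF f, of i "i + k"] by (simp add: algebra_simps)
  qed simp
  from this[of "n - i"] have "f i + (real n - real i) * (f (Suc i) - f i) \<le> f n"
    using i by (simp add: of_nat_diff)
  moreover have "0 \<le> f i" "f n \<le> 1" using f i by (auto simp: convex_profile_def)
  ultimately show ?thesis by linarith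
qed

lemma convex_profile_slope_ge:
  assumes f: "convex_profile n f" and i: "i < n"
  shows "- 1 \<le> real (Suc i) * (f (Suc i) - f i)"
proof -
  have "f k \<le> f 0 + real k * (f (Suc i) - f i)" if "k \<le> Suc i" for k
    using that
  proof (induction k)
    case (Suc k)
    then show ?case using convex_profile_slope_mono[OF f, of k i] i by (simp add: algebra_simps)
  qed simp
  from this[of "Suc i"] have "f (Suc i) \<le> f 0 + real (Suc i) * (f (Suc i) - f i)" by simp
  moreover have "0 \<le> f (Suc i)" "f 0 = 1" using f i by (auto simp: convex_profile_def)
  ultimately show ?thesis by linarith
qed

section \<open>Weighted energy and potential on the segment\<close>

definition edge_weight :: "nat \<Rightarrow> nat \<Rightarrow> real" where
  "edge_weight n i = real i * (real n - 1 - real i)"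

text \<open>The weight vanishes on the two boundary edges, where the slopes of the profile are large.\<close>

definition segment_energy :: "nat \<Rightarrow> (nat \<Rightarrow> real) \<Rightarrow> real" where
  "segment_energy n f = (\<Sum>i<n. (edge_weight n i * (f (Suc i) - f i))\<^sup>2)"

definition vertex_weight :: "nat \<Rightarrow> nat \<Rightarrow> real" where
  "vertex_weight n i = 2 * real i * (real n - real i) - real n"

lemma vertex_weight_eq: "1 \<le> i \<Longrightarrow> vertex_weight n i = edge_weight n i + edge_weight n (i - 1)"
  by (simp add: vertex_weight_def edge_weight_def of_nat_diff algebra_simps)

lemma vertex_weight_nonneg:
  assumes "1 \<le> i" "i < n" shows "0 \<le> vertex_weight n i"
proof -
  have "(real i - 1) * (real n - real i - 1) \<ge> 0" using assms by (intro mult_nonneg_nonneg) auto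
  moreover have "real n \<ge> 2" using assms by simp
  ultimately show ?thesis by (simp add: vertex_weight_def algebra_simps)
qed

lemma sum_vertex_weight:
  assumes "n \<ge> 1"
  shows "(\<Sum>i=1..<n. vertex_weight n i) = real n * (real n - 1) * (real n - 2) / 3"
proof -
  \<comment> \<open>The parameter \<open>N\<close> is separated from the summation bound, so that
    the induction on \<open>m\<close> leaves the weights fixed.\<close>
  have "(\<Sum>i=1..<m. 2 * real i * (N - real i) - N)
      = N * real m * (real m - 1) - (real m - 1) * real m * (2 * real m - 1) / 3 - N * (real m - 1)" if "m \<ge> 1" for m :: nat and N :: real
    using that
  proof (induction m rule: dec_induct)
    case (step m)
    then show ?case by (simp add: field_simps)
  qed simp
  from this[OF assms, of "real n"] show ?thesis by (simp add: vertex_weight_def field_simps)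
qed

text \<open>The slopes \<open>c - \<delta>\<close> and \<open>c + \<delta>\<close> at
  \<open>i\<close> both become \<open>c\<close>. The quadratic gain is at least half of the squared
  weight sum times \<open>\<delta>\<^sup>2\<close>; the cross term is controlled because steep
  slopes occur only near an end, where the weights are small.\<close>

lemma segment_energy_update:
  assumes f: "convex_profile n f" and i: "1 \<le> i" "i < n"
    and \<delta>: "\<delta> = (f (i - 1) + f (i + 1)) / 2 - f i"
  shows "segment_energy n (f(i := (f (i - 1) + f (i + 1)) / 2))
    \<le> segment_energy n f - (vertex_weight n i)\<^sup>2 / 2 * \<delta>\<^sup>2 + 4 * (real n)\<^sup>2 * \<delta>"
proof -
  obtain k where k: "i = Suc k" using i by (cases i) auto
  let ?g = "f(i := (f (i - 1) + f (i + 1)) / 2)"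
  define e where "e f j = (edge_weight n j * (f (Suc j) - f j))\<^sup>2" for f j
  define c where "c = (f (i + 1) - f (i - 1)) / 2"
  let ?p = "edge_weight n i" and ?p' = "edge_weight n k" and ?u = "vertex_weight n i"
  have split: "segment_energy n f' = e f' k + e f' i + (\<Sum>j\<in>{..<n} - {k, i}. e f' j)" for f'
  proof -
    have "{..<n} = insert k (insert i ({..<n} - {k, i}))" using i k by auto
    then have "segment_energy n f' = (\<Sum>j\<in>insert k (insert i ({..<n} - {k, i})). e f' j)"
      unfolding segment_energy_def e_def by simp
    then show ?thesis using k by simp
  qed
  have same: "(\<Sum>j\<in>{..<n} - {k, i}. e ?g j) = (\<Sum>j\<in>{..<n} - {k, i}. e f j)"
    using k by (intro sum.cong) (auto simp: e_def)
  have "\<delta> \<ge> 0" using convex_profileD[OF f i] \<delta> by simp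
  have slopes: "f i - f k = c - \<delta>" "f (Suc i) - f i = c + \<delta>" "?g i - ?g k = c" "?g (Suc i) - ?g i = c"
    using k by (simp_all add: c_def \<delta> field_simps)
  have "e ?g k + e ?g i - (e f k + e f i) = (?p' * c)\<^sup>2 + (?p * c)\<^sup>2 - (?p' * (c - \<delta>))\<^sup>2 - (?p * (c + \<delta>))\<^sup>2"
    unfolding e_def k[symmetric] slopes by simp
  also have "\<dots> = - (?p'\<^sup>2 + ?p\<^sup>2) * \<delta>\<^sup>2 + 2 * \<delta> * (c * ((?p' - ?p) * (?p + ?p')))"
    by (simp add: power2_eq_square algebra_simps)
  also have "?p' - ?p = 2 * real i - real n" by (simp add: k edge_weight_def algebra_simps)
  also have "?p + ?p' = ?u" using vertex_weight_eq[OF i(1)] k by simp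
  also have "c * ((2 * real i - real n) * ?u) \<le> 2 * (real n)\<^sup>2"
  proof -
    have u: "0 \<le> ?u" by (rule vertex_weight_nonneg[OF i])
    \<comment> \<open>One estimate for both halves: \<open>z\<close> is the distance to the nearer
      end, \<open>y\<close> the distance of \<open>2 * i\<close> from \<open>n\<close>, and
      \<open>x\<close> is \<open>c\<close> on the right and \<open>- c\<close> on the left.\<close>
    have bound: "x * (y * ?u) \<le> 2 * (real n)\<^sup>2"
      if "0 \<le> y" "y \<le> real n" "x * z \<le> 1" "0 \<le> z" "?u \<le> 2 * real n * z" for x y z
    proof (cases "x \<le> 0")
      case True
      then have "x * (y * ?u) \<le> 0" using that u by (intro mult_nonpos_nonneg) auto
      then show ?thesis by (rule order_trans) simp
    next
      case False
      then have "x * ?u \<le> x * (2 * real n * z)" using that by (intro mult_left_mono) auto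
      also have "\<dots> = 2 * real n * (x * z)" by simp
      also have "\<dots> \<le> 2 * real n * 1" using that by (intro mult_left_mono) auto
      finally have "x * ?u \<le> 2 * real n" by simp
      then have "y * (x * ?u) \<le> real n * (2 * real n)" using that u False
        by (intro mult_mono[of y _ "x * ?u"]) auto
      then show ?thesis by (simp add: power2_eq_square algebra_simps)
    qed
    show ?thesis
    proof (cases "n \<le> 2 * i")
      case True
      have "(real n - real i) * c \<le> (real n - real i) * (c + \<delta>)"
        using i \<open>\<delta> \<ge> 0\<close> by (intro mult_left_mono) auto
      also have "\<dots> \<le> 1" using convex_profile_slope_le[OF f i(2)] slopes by simp
      finally have "c * (real n - real i) \<le> 1" by (simp add: mult.commute)
      moreover have "?u \<le> 2 * real n * (real n - real i)"
      proof -
        have "real i * (real n - real i) \<le> real n * (real n - real i)"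
          using i by (intro mult_right_mono) auto
        then show ?thesis by (simp add: vertex_weight_def)
      qed
      ultimately show ?thesis using True i by (intro bound[where z = "real n - real i"]) auto
    next
      case False
      have "- 1 \<le> real i * (c - \<delta>)" using convex_profile_slope_ge[OF f, of k] slopes i k by simp
      also have "\<dots> \<le> real i * c" using \<open>\<delta> \<ge> 0\<close> by (intro mult_left_mono) auto
      finally have "(- c) * real i \<le> 1" by (simp add: mult.commute)
      moreover have "?u \<le> 2 * real n * real i"
      proof -
        have "real i * (real n - real i) \<le> real i * real n" by (intro mult_left_mono) auto
        then show ?thesis by (simp add: vertex_weight_def algebra_simps)
      qed
      ultimately have "(- c) * ((real n - 2 * real i) * ?u) \<le> 2 * (real n)\<^sup>2"
        using False i by (intro bound[where z = "real i"]) auto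
      then show ?thesis by (simp add: algebra_simps)
    qed
  qed
  then have "- (?p'\<^sup>2 + ?p\<^sup>2) * \<delta>\<^sup>2 + 2 * \<delta> * (c * ((2 * real i - real n) * ?u))
      \<le> - (?p'\<^sup>2 + ?p\<^sup>2) * \<delta>\<^sup>2 + 2 * \<delta> * (2 * (real n)\<^sup>2)"
    using \<open>\<delta> \<ge> 0\<close> by (intro add_left_mono mult_left_mono) auto
  also have "\<dots> \<le> - (?u\<^sup>2 / 2) * \<delta>\<^sup>2 + 4 * (real n)\<^sup>2 * \<delta>"
  proof -
    have "?u\<^sup>2 / 2 \<le> ?p'\<^sup>2 + ?p\<^sup>2"
      using sum_squares_bound[of ?p ?p'] vertex_weight_eq[OF i(1)] k
      by (simp add: power2_eq_square algebra_simps)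
    then have "?u\<^sup>2 / 2 * \<delta>\<^sup>2 \<le> (?p'\<^sup>2 + ?p\<^sup>2) * \<delta>\<^sup>2" by (rule mult_right_mono) simp
    then show ?thesis by (simp add: algebra_simps)
  qed
  finally show ?thesis unfolding split[of f] split[of ?g] same by linarith
qed

text \<open>The linear part is the quantity that has to grow to order \<open>n ^ 3\<close>. The
  energy pays for the growth in one step, and the last sum cancels the error
  \<open>4 * n ^ 2 * \<delta>\<close> of the energy estimate. The divisor \<open>216\<close> keeps
  the loss from that sum at \<open>n ^ 3 / 54\<close>.\<close>

definition segment_potential :: "nat \<Rightarrow> (nat \<Rightarrow> real) \<Rightarrow> real" where
  "segment_potential n f = (\<Sum>i=1..<n. vertex_weight n i * f i)
     + (segment_energy n f - 4 * (real n)\<^sup>2 * (\<Sum>i=1..<n. f i)) / 216"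

lemma segment_potential_update:
  assumes f: "convex_profile n f" and i: "1 \<le> i" "i < n"
  shows "segment_potential n (f(i := (f (i - 1) + f (i + 1)) / 2)) \<le> segment_potential n f + 108"
proof -
  define y where "y = (f (i - 1) + f (i + 1)) / 2"
  define \<delta> where "\<delta> = y - f i"
  let ?u = "vertex_weight n i"
  have lin: "(\<Sum>j=1..<n. w j * (f(i := y)) j) = (\<Sum>j=1..<n. w j * f j) + w i * \<delta>" for w :: "nat \<Rightarrow> real"
  proof -
    have "(\<Sum>j=1..<n. w j * (f(i := y)) j) = (\<Sum>j=1..<n. w j * f j + (if j = i then w i * \<delta> else 0))"
      by (intro sum.cong) (auto simp: \<delta>_def algebra_simps)
    then show ?thesis using i by (simp add: sum.distrib)
  qed
  have "segment_energy n (f(i := y))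
      \<le> segment_energy n f - ?u\<^sup>2 / 2 * \<delta>\<^sup>2 + 4 * (real n)\<^sup>2 * \<delta>"
    unfolding y_def using f i by (intro segment_energy_update) (auto simp: \<delta>_def y_def)
  \<comment> \<open>Arithmetic-geometric mean inequality, with the number \<open>216\<close> fixed
    by the potential.\<close>
  moreover have "?u * \<delta> \<le> ?u\<^sup>2 / 2 * \<delta>\<^sup>2 / 216 + 108"
    using zero_le_power2[of "?u * \<delta> - 216"] by (simp add: power2_eq_square field_simps)
  ultimately have "segment_potential n (f(i := y)) \<le> segment_potential n f + 108"
    using lin[of "vertex_weight n"] lin[of "\<lambda>_. 1"]
    by (simp add: segment_potential_def field_simps)
  then show ?thesis by (simp add: y_def)
qed

text \<open>The initial jumps sit on the two boundary edges, where the weight vanishes.\<close>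

lemma segment_potential_profile: "n \<ge> 2 \<Longrightarrow> segment_potential n (segment_profile n) = 0"
proof -
  assume n: "n \<ge> 2"
  have inner: "segment_profile n i = 0" if "1 \<le> i" "i < n" for i
    using that by (auto simp: segment_profile_def segment_boundary_def)
  have "edge_weight n i * (segment_profile n (Suc i) - segment_profile n i) = 0" if "i < n" for i
  proof (cases "i = 0 \<or> Suc i = n")
    case True
    then show ?thesis by (auto simp: edge_weight_def)
  next
    case False
    then show ?thesis using that inner[of i] inner[of "Suc i"] by simp
  qed
  then have "segment_energy n (segment_profile n) = 0"
    unfolding segment_energy_def by (intro sum.neutral) auto
  then show ?thesis using inner by (simp add: segment_potential_def)
qed

lemma segment_potential_lipschitz_learning:
  assumes n: "n \<ge> 2" and v: "\<And>t. t \<ge> 1 \<Longrightarrow> v t \<in> segment_interior n"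
  defines "f \<equiv> lipschitz_learning (segment_graph n) (segment_profile n) v"
  shows "convex_profile n (f t) \<and> segment_potential n (f t) \<le> 108 * real t"
proof (induction t)
  case 0
  then show ?case using convex_profile_segment[OF n] segment_potential_profile[OF n] by (simp add: f_def)
next
  case (Suc t)
  let ?i = "v (Suc t)"
  have vi: "?i \<in> segment_interior n" using v by simp
  then have i: "1 \<le> ?i" "?i < n" by (auto simp: segment_interior_def)
  have eq: "f (Suc t) = (f t)(?i := (f t (?i - 1) + f t (?i + 1)) / 2)"
    by (simp add: f_def midrange_segment[OF vi])
  from Suc have f: "convex_profile n (f t)" and pot: "segment_potential n (f t) \<le> 108 * real t" by auto
  have "convex_profile n (f (Suc t))" unfolding eq by (rule convex_profile_update[OF f i])
  moreover have "segment_potential n (f (Suc t)) \<le> segment_potential n (f t) + 108"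
    unfolding eq by (rule segment_potential_update[OF f i])
  ultimately show ?case using pot by simp
qed

text \<open>Accuracy \<open>1 / 2\<close> forces \<open>f\<close> to be at least
  \<open>1 / 2\<close> everywhere, hence the linear part to be at least half the sum of the vertex
  weights, while the potential gains at most \<open>108\<close> per step.\<close>

lemma segment_approximation_time_ge:
  assumes n: "n \<ge> 2" and v: "\<And>t. t \<ge> 1 \<Longrightarrow> v t \<in> segment_interior n"
    and h: "infinity_harmonic_extension (segment_graph n) (segment_interior n)
      (segment_boundary n) (segment_profile n) h"
    and close: "sup_norm (segment_graph n)
      (\<lambda>x. lipschitz_learning (segment_graph n) (segment_profile n) v t x - h x) \<le> 1 / 2"
  shows "real n ^ 3 / 5832 \<le> real t"
proof -
  define f where "f = lipschitz_learning (segment_graph n) (segment_profile n) v t"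
  have ge: "1 / 2 \<le> f i" if "i \<le> n" for i
  proof -
    have "\<bar>f i - h i\<bar> \<le> sup_norm (segment_graph n) (\<lambda>x. f x - h x)"
      unfolding sup_norm_def using that by (intro Max_ge) (auto simp: segment_graph_def)
    then have "\<bar>f i - h i\<bar> \<le> 1 / 2" using close by (simp add: f_def)
    then show ?thesis using segment_harmonic_ge_1[OF h that] by linarith
  qed
  have pot: "convex_profile n f" "segment_potential n f \<le> 108 * real t"
    using segment_potential_lipschitz_learning[OF n v] by (auto simp: f_def)
  show ?thesis
  proof (cases "n = 2")
    \<comment> \<open>For \<open>n = 2\<close> the vertex weights sum to zero and the potential says
      nothing, but one update is certainly needed.\<close>
    case True
    have "t \<noteq> 0"
    proof
      assume "t = 0"
      then show False using ge[of 1] True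
        by (simp add: f_def segment_profile_def segment_boundary_def)
    qed
    then show ?thesis using True by simp
  next
    case False
    then have n3: "real n \<ge> 3" using n by simp
    have "(\<Sum>i=1..<n. vertex_weight n i * (1 / 2)) \<le> (\<Sum>i=1..<n. vertex_weight n i * f i)"
      using ge vertex_weight_nonneg by (intro sum_mono mult_left_mono) auto
    then have U: "real n * (real n - 1) * (real n - 2) / 6 \<le> (\<Sum>i=1..<n. vertex_weight n i * f i)"
      using sum_vertex_weight[of n] n by (simp flip: sum_divide_distrib)
    have "(\<Sum>i=1..<n. f i) \<le> (\<Sum>i=1..<n. 1)"
      using pot(1) by (intro sum_mono) (auto simp: convex_profile_def)
    then have "4 * (real n)\<^sup>2 * (\<Sum>i=1..<n. f i) \<le> 4 * (real n)\<^sup>2 * real n"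
      by (intro mult_left_mono) auto
    also have "\<dots> = 4 * real n ^ 3" by (simp add: power2_eq_square power3_eq_cube)
    finally have "4 * (real n)\<^sup>2 * (\<Sum>i=1..<n. f i) \<le> 4 * real n ^ 3" .
    moreover have "0 \<le> segment_energy n f" by (simp add: segment_energy_def sum_nonneg)
    moreover have "a - c / 54 \<le> d"
      if "q \<le> 4 * c" "0 \<le> w" "a \<le> u" "u + (w - q) / 216 \<le> d" for a c d q u w :: real
      using that by (simp add: field_simps)
    ultimately have "real n * (real n - 1) * (real n - 2) / 6 - real n ^ 3 / 54 \<le> 108 * real t"
      using U pot(2) unfolding segment_potential_def by blast
    moreover have "real n ^ 3 / 27 \<le> real n * (real n - 1) * (real n - 2) / 6"
    proof -
      \<comment> \<open>This product is \<open>54\<close> times the difference of the two sides;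
        equality holds at \<open>n = 3\<close>.\<close>
      have "0 \<le> real n * ((real n - 3) * (7 * real n - 6))" using n3 by (intro mult_nonneg_nonneg) auto
      then show ?thesis by (simp add: power3_eq_cube field_simps)
    qed
    ultimately show ?thesis by simp
  qed
qed

theorem theorem1p7:
  shows
    "(\<forall>(G :: 'a pair_pre_digraph) V B n (f0 :: 'a \<Rightarrow> real) h (M :: 'w measure) X.
        boundary_graph G V B \<longrightarrow>
        Digraph_Component.connected (with_proj G) \<longrightarrow>
        card V = n \<longrightarrow>
        (\<forall>x\<in>V \<union> B. f0 x \<in> {0..1}) \<longrightarrow>
        infinity_harmonic_extension G V B f0 h \<longrightarrow>
        prob_space M \<longrightarrow>
        iid_uniform_updates M V X \<longrightarrow>
        (\<forall>t. let err = (\<lambda>\<omega>. l1_norm G (\<lambda>x. lipschitz_learning G f0 (\<lambda>s. X s \<omega>) t x - h x)) in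
           integrable M err \<and>
           integral\<^sup>L M err \<le> real n * exp (- real t / (2 * real n ^ 3))) \<and>
        (\<forall>\<epsilon>::real. 0 < \<epsilon> \<and> \<epsilon> < 1 \<longrightarrow>
           (let \<tau> = (\<lambda>\<omega>. ennreal_of_enat (approximation_time G f0 h (\<lambda>s. X s \<omega>) \<epsilon>)) in
              \<tau> \<in> borel_measurable M \<and>
              integral\<^sup>N M \<tau> \<le> ennreal (1 + 2 * real n ^ 3 * ln (real n * exp 1 / \<epsilon>)))))
     \<and>
     (\<exists>c::real. c > 0 \<and>
        (\<forall>n\<ge>2. \<forall>h v.
           infinity_harmonic_extension (segment_graph n) (segment_interior n) (segment_boundary n)
             (segment_profile n) h \<longrightarrow>
           (\<forall>t\<ge>1. v t \<in> segment_interior n) \<longrightarrow>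
           ennreal_of_enat
             (approximation_time (segment_graph n) (segment_profile n) h v (1/2))
             \<ge> ennreal (c * real n ^ 3)))"
proof (intro conjI allI impI)
  fix G :: "'a pair_pre_digraph" and V B n and f0 h :: "'a \<Rightarrow> real" and M :: "'w measure" and X
  assume "boundary_graph G V B" "Digraph_Component.connected (with_proj G)"
    and n: "card V = n" and f0: "\<forall>x\<in>V \<union> B. f0 x \<in> {0..1}"
    and ext: "infinity_harmonic_extension G V B f0 h"
    and M: "prob_space M" and iid: "iid_uniform_updates M V X"
  then interpret connected_boundary_graph G V B
    by (simp add: connected_boundary_graph_def connected_boundary_graph_axioms_def)
  have f: "f0 x \<in> {0..1}" if "x \<in> V \<union> B" for x using f0 that by blast
  show "let err = (\<lambda>\<omega>. l1_norm G (\<lambda>x. lipschitz_learning G f0 (\<lambda>s. X s \<omega>) t x - h x)) in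
      integrable M err \<and> integral\<^sup>L M err \<le> real n * exp (- real t / (2 * real n ^ 3))" for t
    using expected_l1_error[OF ext f M iid, of t] by (simp add: Let_def n)
  show "let \<tau> = (\<lambda>\<omega>. ennreal_of_enat (approximation_time G f0 h (\<lambda>s. X s \<omega>) \<epsilon>)) in
      \<tau> \<in> borel_measurable M \<and>
      integral\<^sup>N M \<tau> \<le> ennreal (1 + 2 * real n ^ 3 * ln (real n * exp 1 / \<epsilon>))"
    if "0 < \<epsilon> \<and> \<epsilon> < 1" for \<epsilon> :: real
  proof -
    have "(\<lambda>\<omega>. ennreal_of_enat (approximation_time G f0 h (\<lambda>s. X s \<omega>) \<epsilon>)) \<in> borel_measurable M"
      using measurable_approximation_time[OF M iid] by (rule measurable_compose) simp
    then show ?thesis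
      using expected_approximation_time[OF ext f M iid, of \<epsilon>] that by (simp add: Let_def n)
  qed
next
  show "\<exists>c::real. c > 0 \<and>
      (\<forall>n\<ge>2. \<forall>h v.
         infinity_harmonic_extension (segment_graph n) (segment_interior n) (segment_boundary n)
           (segment_profile n) h \<longrightarrow>
         (\<forall>t\<ge>1. v t \<in> segment_interior n) \<longrightarrow>
         ennreal_of_enat
           (approximation_time (segment_graph n) (segment_profile n) h v (1/2))
           \<ge> ennreal (c * real n ^ 3))"
  \<comment> \<open>The constant arises as \<open>5832 = 54 * 108\<close>: the potential must reach
    \<open>n ^ 3 / 27 - n ^ 3 / 54\<close> at \<open>108\<close> per step.\<close>
  proof (intro exI[of _ "1 / 5832"] conjI allI impI)
    fix n :: nat and h and v :: "nat \<Rightarrow> nat"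
    assume n: "n \<ge> 2" and v: "\<forall>t\<ge>1. v t \<in> segment_interior n"
      and h: "infinity_harmonic_extension (segment_graph n) (segment_interior n)
        (segment_boundary n) (segment_profile n) h"
    let ?\<tau> = "approximation_time (segment_graph n) (segment_profile n) h v (1 / 2)"
    show "ennreal (1 / 5832 * real n ^ 3) \<le> ennreal_of_enat ?\<tau>"
    proof (cases ?\<tau>)
      case (enat t)
      then have "sup_norm (segment_graph n)
          (\<lambda>x. lipschitz_learning (segment_graph n) (segment_profile n) v t x - h x) \<le> 1 / 2"
        unfolding approximation_time_def Inf_enat_image_eq_iff by blast
      then have "real n ^ 3 / 5832 \<le> real t"
        using v by (intro segment_approximation_time_ge[OF n _ h]) auto
      then have "ennreal (1 / 5832 * real n ^ 3) \<le> ennreal (real t)" by (intro ennreal_leI) simp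
      then show ?thesis by (simp add: enat ennreal_of_nat_eq_real_of_nat)
    qed simp
  qed simp
qed

end
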